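(* Let $N$ be a $K$-champion number with prime factorization $N=2^{\alpha_1}3^{\alpha_2}\cdots p_k^{\alpha_k}$, $\alpha_1\ge\alpha_2\ge\cdots\ge\alpha_k\ge1$. As $N\to+\infty$ through $K$-champion numbers, $$\Omega(N)=\alpha_1+\alpha_2+\cdots+\alpha_k=b\log N+O\big((\log N)^{\delta}\big),$$ where $$\beta_i=\frac{a}{p_i^{\rho}-1}\ (i\ge1),\qquad b=\sum_{i=1}^{\infty}\beta_i=0.8612985\ldots$$ Moreover, for $1\le i\le k$, uniformly in $i$, $$\alpha_i=\beta_i\log N+O\left(\frac{(\log N)^{\delta}}{\log p_i}\right).$$
   Context: $K$ is the Kalmár function: $K(1)=1$ and, for $n\ge 2$, $K(n)$ is the number of ordered factorizations $n=x_1x_2\cdots x_r$ ($r\ge1$ arbitrary) into integers $x_i\ge 2$. A positive integer $N$ is a $K$-champion if $K(M)<K(N)$ for every positive integer $M<N$; since $K(n)$ depends only on the multiset of exponents in the prime factorization of $n$, every $K$-champion has the form $2^{\alpha_1}3^{\alpha_2}\cdots p_k^{\alpha_k}$ with $\alpha_1\ge\cdots\ge\alpha_k\ge1$, where $p_i$ is the $i$-th prime. $\rho=1.7286\ldots$ is the unique real number $>1$ with $\zeta(\rho)=2$ ($\zeta$ the Riemann zeta function); $a=1.10002\ldots$ is defined by $\frac1a=\sum_{i=1}^{\infty}\frac{\log p_i}{p_i^{\rho}-1}$; $\delta=(1+1/\rho)/2=0.789243\ldots$. The implied constants in the $O$'s are absolute.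
   Formalization: The printed decimal b = 0.8612985… is not asserted: it contradicts the definition b = Σβ_i, which gives b = 0.8613019…; b is taken as the exact sum and everything else is as stated. *)

theory Defs
  imports
    Complex_Main
    "HOL-Library.Landau_Symbols"
    "HOL-Library.Infinite_Set"
    "HOL-Computational_Algebra.Primes"
begin

definition ordered_factorizations :: "nat \<Rightarrow> nat list set" where
  "ordered_factorizations n = {xs. xs \<noteq> [] \<and> (\<forall>x\<in>set xs. 2 \<le> x) \<and> prod_list xs = n}"

text \<open>Only used for positive arguments.\<close>
definition kalmar_K :: "nat \<Rightarrow> nat" where
  "kalmar_K n = (if n = 1 then 1 else card (ordered_factorizations n))"

definition K_champion :: "nat \<Rightarrow> bool" where
  "K_champion N \<longleftrightarrow> 0 < N \<and> (\<forall>M. 0 < M \<and> M < N \<longrightarrow> kalmar_K M < kalmar_K N)"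

text \<open>\<open>nth_pr i\<close> is the \<open>i\<close>-th prime counted from 1; index 0 is junk and never used.\<close>
definition nth_pr :: "nat \<Rightarrow> nat" where
  "nth_pr i = enumerate {p. prime p} (i - 1)"

definition descending_factorization :: "nat \<Rightarrow> nat \<Rightarrow> (nat \<Rightarrow> nat) \<Rightarrow> bool" where
  "descending_factorization N k \<alpha> \<longleftrightarrow>
     N = (\<Prod>i=1..k. nth_pr i ^ \<alpha> i) \<and> antimono_on {1..k} \<alpha> \<and> (\<forall>i\<in>{1..k}. 1 \<le> \<alpha> i)"

definition prime_Omega :: "nat \<Rightarrow> nat" where
  "prime_Omega N = size (prime_factorization N)"

text \<open>The Riemann zeta function on the half-line \<open>s > 1\<close>, where its Dirichlet series converges.\<close>
definition zeta_real :: "real \<Rightarrow> real" where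
  "zeta_real s = (\<Sum>n. 1 / real (Suc n) powr s)"

definition kalmar_rho :: real where
  "kalmar_rho = (THE r. 1 < r \<and> zeta_real r = 2)"

definition kalmar_a :: real where
  "kalmar_a = 1 / (\<Sum>i. ln (real (nth_pr (Suc i))) / (real (nth_pr (Suc i)) powr kalmar_rho - 1))"

definition kalmar_delta :: real where
  "kalmar_delta = (1 + 1 / kalmar_rho) / 2"

definition kalmar_beta :: "nat \<Rightarrow> real" where
  "kalmar_beta i = kalmar_a / (real (nth_pr i) powr kalmar_rho - 1)"

definition kalmar_b :: real where
  "kalmar_b = (\<Sum>i. kalmar_beta (Suc i))"

text \<open>The filter expressing ``\<open>N \<rightarrow> \<infinity>\<close> through \<open>K\<close>-champion numbers''.\<close>
definition champions_at_top :: "nat filter" where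
  "champions_at_top = inf at_top (principal {N. K_champion N})"

end

theory Submission
  imports Defs
    "HOL-Analysis.Infinite_Sum"
    "HOL-Analysis.Summation_Tests"
    "HOL-Analysis.Uniform_Limit"
begin

text \<open>
  The theorem holds because \<open>K\<close> satisfies a sharp upper bound that is strictly smaller, by a
  quadratic amount, at integers whose exponents are not proportional to
  \<open>1 / (p\<^sup>\<rho> - 1)\<close>, while a champion must come close to the unrestricted bound.

  Upper bound. If \<open>w\<close> is completely multiplicative and \<open>w 2 + w 3 + \<dots> \<le> 1\<close>, then
  \<open>K n * w n \<le> 1\<close>: this is immediate by induction from the recursion of \<open>K\<close> over the first factor
  (\<open>kalmar_K_weight_le\<close>). The weight \<open>m powr -\<rho>\<close> has sum exactly \<open>1\<close> over \<open>m \<ge> 2\<close>, as \<open>\<zeta>(\<rho>) = 2\<close>. It may be tilted to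
  \<open>m powr -\<rho> * exp (x * G m - C * x\<^sup>2 * ln m)\<close> for any completely additive \<open>G\<close> of size
  \<open>O(ln m)\<close> that is orthogonal to \<open>m powr -\<rho>\<close>: the first-order change of the sum vanishes, and the term
  with \<open>C\<close> pays for the second-order change. Hence
  \<open>ln (K n) \<le> \<rho> * ln n - x * G n + C * x\<^sup>2 * ln n\<close> for small \<open>x\<close>, with \<open>C\<close> independent of \<open>G\<close>
  (\<open>kalmar_K_tilted_bound\<close>). For nonnegative \<open>h\<close> on the primes with additive extension \<open>H\<close>, the
  admissible choice is \<open>G m = H m - a * S * ln m\<close> with \<open>S\<close> the sum of \<open>h p / (p\<^sup>\<rho> - 1)\<close>
  over all primes (\<open>additive_ext_has_sum\<close>).

  Lower bound. For \<open>y \<ge> 2\<close> the sum of \<open>K\<close> over the \<open>y\<close>-smooth integers up to \<open>N\<close> is at least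
  \<open>(N / y) powr s\<close> as soon as \<open>s \<ge> 0\<close> and the powers \<open>m powr -s\<close>, \<open>2 \<le> m \<le> y\<close>, have sum at least
  \<open>1\<close>; one may take \<open>s = \<rho> - O(y powr (1 - \<rho>))\<close>. There are at most \<open>(2 * ln N + 1)\<close> to the power
  \<open>\<pi>(y)\<close> such integers, and each of them has \<open>K\<close> at most \<open>K N\<close> if \<open>N\<close> is a champion.
  With \<open>y\<close> about \<open>(ln N) powr (1 / \<rho>)\<close> and Chebyshev's bound for \<open>\<pi>(y)\<close>, all losses are
  \<open>O((ln N) powr (1 / \<rho>))\<close> (\<open>champion_lower_bound\<close>).

  Comparison. For a champion \<open>N\<close> and \<open>L = ln N\<close> the bounds give
  \<open>x * G N \<le> C * x\<^sup>2 * L + C' * L powr (1 / \<rho>)\<close>. The two terms on the right balance at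
  \<open>\<bar>x\<bar> = L powr (\<delta> - 1)\<close>, which yields \<open>\<bar>G N\<bar> = O(L powr \<delta>)\<close> uniformly in \<open>G\<close>
  (\<open>champion_additive_deviation\<close>). The choice \<open>h = 1\<close> gives the statement on \<open>\<Omega>\<close>; the choice of \<open>h\<close>
  supported at \<open>p\<^sub>i\<close> with value \<open>ln p\<^sub>i\<close> gives the one on \<open>\<alpha>\<^sub>i\<close>.
\<close>

section \<open>Ordered factorizations and multiplicative weights\<close>

text \<open>
  Admitting the empty list makes \<open>1\<close> have one factorization, as in the convention \<open>K 1 = 1\<close>; so
  the factorization of \<open>n \<ge> 2\<close> into \<open>n\<close> alone needs no separate term in the recursion over the
  first factor.
\<close>

definition factor_lists :: "nat \<Rightarrow> nat list set" where
  "factor_lists n = {xs. (\<forall>x\<in>set xs. 2 \<le> x) \<and> prod_list xs = n}"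

lemma factor_lists_1: "factor_lists 1 = {[]}"
proof -
  have "xs = []" if "\<forall>x\<in>set xs. 2 \<le> x" "prod_list xs = 1" for xs :: "nat list"
    using that by (cases xs) auto
  then show ?thesis by (auto simp: factor_lists_def)
qed

lemma kalmar_K_eq_card: "kalmar_K n = card (factor_lists n)"
proof (cases "n = 1")
  case True
  have "kalmar_K n = 1" using True by (simp add: kalmar_K_def)
  also have "1 = card (factor_lists n)" unfolding True factor_lists_1 by simp
  finally show ?thesis .
next
  case False
  then have "ordered_factorizations n = factor_lists n"
    by (auto simp: factor_lists_def ordered_factorizations_def)
  with False show ?thesis by (simp add: kalmar_K_def)
qed

lemma factor_lists_Cons:
  assumes "2 \<le> n"
  shows "factor_lists n = (\<Union>m\<in>{m. 2 \<le> m \<and> m dvd n}. (#) m ` factor_lists (n div m))"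
proof (intro equalityI subsetI)
  fix xs assume xs: "xs \<in> factor_lists n"
  then obtain m ys where [simp]: "xs = m # ys"
    using assms by (cases xs) (auto simp: factor_lists_def)
  show "xs \<in> (\<Union>m\<in>{m. 2 \<le> m \<and> m dvd n}. (#) m ` factor_lists (n div m))"
    using xs by (auto simp: factor_lists_def)
qed (auto simp: factor_lists_def)

lemma finite_divisors_ge_2: "2 \<le> n \<Longrightarrow> finite {m::nat. 2 \<le> m \<and> m dvd n}"
  by (rule finite_subset[of _ "{..n}"]) (auto dest: dvd_imp_le)

lemma finite_factor_lists: "1 \<le> n \<Longrightarrow> finite (factor_lists n)"
proof (induction n rule: less_induct)
  case (less n)
  show ?case
  proof (cases "n = 1")
    case True
    then show ?thesis using factor_lists_1 by simp
  next
    case False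
    then have n: "2 \<le> n" using less.prems by simp
    have "finite (factor_lists (n div m))" if "2 \<le> m" "m dvd n" for m
    proof (rule less.IH)
      show "n div m < n" using n that by simp
      show "1 \<le> n div m" using n that by (simp add: Suc_le_eq div_greater_zero_iff dvd_imp_le)
    qed
    then show ?thesis
      unfolding factor_lists_Cons[OF n] using finite_divisors_ge_2[OF n] by blast
  qed
qed

lemma kalmar_K_rec:
  assumes "2 \<le> n"
  shows "kalmar_K n = (\<Sum>m | 2 \<le> m \<and> m dvd n. kalmar_K (n div m))"
proof -
  have fin: "finite (factor_lists (n div m))" if "2 \<le> m" "m dvd n" for m
    by (rule finite_factor_lists)
      (use assms that in \<open>simp add: Suc_le_eq div_greater_zero_iff dvd_imp_le\<close>)
  have "card (factor_lists n) = (\<Sum>m | 2 \<le> m \<and> m dvd n. card ((#) m ` factor_lists (n div m)))"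
    unfolding factor_lists_Cons[OF assms]
    by (rule card_UN_disjoint) (use finite_divisors_ge_2[OF assms] fin in auto)
  also have "\<dots> = (\<Sum>m | 2 \<le> m \<and> m dvd n. card (factor_lists (n div m)))"
    by (intro sum.cong refl card_image) (auto simp: inj_on_def)
  finally show ?thesis by (simp add: kalmar_K_eq_card)
qed

lemma kalmar_K_1: "kalmar_K (Suc 0) = 1"
  by (simp add: kalmar_K_def)

lemma kalmar_K_pos: "1 \<le> n \<Longrightarrow> 1 \<le> kalmar_K n"
proof (cases "n = 1")
  case False
  assume "1 \<le> n"
  with False have n: "2 \<le> n" by simp
  have "kalmar_K (n div n) \<le> (\<Sum>m | 2 \<le> m \<and> m dvd n. kalmar_K (n div m))"
    by (rule member_le_sum) (use n finite_divisors_ge_2[OF n] in auto)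
  then show ?thesis using n kalmar_K_rec[OF n] kalmar_K_1 by simp
qed (simp add: kalmar_K_1)

text \<open>
  Dividing out the first factor gives \<open>K n * w n = (\<Sum>m. w m * (K (n div m) * w (n div m)))\<close> over the
  divisors \<open>m \<ge> 2\<close> of \<open>n\<close>, a subconvex combination of values that are at most \<open>1\<close> by induction.
\<close>

lemma kalmar_K_weight_le:
  fixes w :: "nat \<Rightarrow> real"
  assumes nonneg: "\<And>m. 1 \<le> m \<Longrightarrow> 0 \<le> w m" and w1: "w 1 = 1"
    and mult: "\<And>m n. 1 \<le> m \<Longrightarrow> 1 \<le> n \<Longrightarrow> w (m * n) = w m * w n"
    and total: "\<And>n. (\<Sum>m=2..n. w m) \<le> 1"
    and "1 \<le> n"
  shows "real (kalmar_K n) * w n \<le> 1"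
  using \<open>1 \<le> n\<close>
proof (induction n rule: less_induct)
  case (less n)
  show ?case
  proof (cases "n = 1")
    case True
    then show ?thesis using w1 kalmar_K_1 by simp
  next
    case False
    then have n: "2 \<le> n" using less.prems by simp
    have step: "real (kalmar_K (n div m)) * w n \<le> w m" if "2 \<le> m" "m dvd n" for m
    proof -
      have q: "1 \<le> n div m" "n div m < n" using n that by (simp_all add: Suc_le_eq div_greater_zero_iff dvd_imp_le)
      have "w n = w m * w (n div m)"
        using mult[of m "n div m"] that q by simp
      then have "real (kalmar_K (n div m)) * w n = w m * (real (kalmar_K (n div m)) * w (n div m))"
        by simp
      also have "\<dots> \<le> w m * 1"
        by (intro mult_left_mono less.IH nonneg) (use q that in auto)
      finally show ?thesis by simp
    qed
    have "real (kalmar_K n) * w n = (\<Sum>m | 2 \<le> m \<and> m dvd n. real (kalmar_K (n div m)) * w n)"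
      by (simp add: kalmar_K_rec[OF n] sum_distrib_right)
    also have "\<dots> \<le> (\<Sum>m | 2 \<le> m \<and> m dvd n. w m)"
      by (rule sum_mono) (use step in auto)
    also have "\<dots> \<le> (\<Sum>m=2..n. w m)"
      by (rule sum_mono2) (use n in \<open>auto dest: dvd_imp_le intro!: nonneg\<close>)
    also have "\<dots> \<le> 1" by (rule total)
    finally show ?thesis .
  qed
qed

section \<open>The exponent rho\<close>

lemma has_sum_from_1:
  fixes f :: "nat \<Rightarrow> real"
  assumes "\<And>n. 1 \<le> n \<Longrightarrow> 0 \<le> f n" "(\<lambda>n. f (Suc n)) sums S"
  shows "(f has_sum S) {1..}"
proof -
  have "((\<lambda>n. f (Suc n)) has_sum S) UNIV"
    by (rule sums_nonneg_imp_has_sum) (use assms in auto)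
  moreover have "bij_betw Suc UNIV {1..}"
    by (auto simp: bij_betw_def image_iff Suc_le_eq gr0_conv_Suc)
  ultimately show ?thesis
    using has_sum_reindex_bij_betw[of Suc UNIV "{1..}" f S] by simp
qed

lemma zeta_real_summable: "1 < s \<Longrightarrow> summable (\<lambda>n. 1 / real (Suc n) powr s)"
proof -
  assume "1 < s"
  then have "summable (\<lambda>n. real n powr (-s))"
    by (simp add: summable_real_powr_iff)
  then have "summable (\<lambda>n. real (Suc n) powr (-s))"
    by (subst summable_Suc_iff)
  then show ?thesis by (simp add: powr_minus field_simps)
qed

lemma zeta_real_strict_antimono:
  assumes "1 < s" "s < t"
  shows "zeta_real t < zeta_real s"
proof -
  have le: "1 / real (Suc n) powr t \<le> 1 / real (Suc n) powr s" for n
    using assms by (intro divide_left_mono powr_mono) auto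
  have "0 < (\<Sum>n. 1 / real (Suc n) powr s - 1 / real (Suc n) powr t)"
  proof (rule suminf_pos2[where i = 1])
    show "summable (\<lambda>n. 1 / real (Suc n) powr s - 1 / real (Suc n) powr t)"
      using assms by (intro summable_diff zeta_real_summable) auto
  next
    fix n show "0 \<le> 1 / real (Suc n) powr s - 1 / real (Suc n) powr t" using le[of n] by simp
  next
    show "0 < 1 / real (Suc 1) powr s - 1 / real (Suc 1) powr t"
      using assms by (simp add: divide_strict_left_mono)
  qed
  also have "\<dots> = zeta_real s - zeta_real t"
    unfolding zeta_real_def using assms by (intro suminf_diff[symmetric] zeta_real_summable) auto
  finally show ?thesis by simp
qed

lemma zeta_real_continuous:
  assumes "1 < s"
  shows "continuous_on {s..} zeta_real"
proof -
  have "uniform_limit {s..} (\<lambda>n x. \<Sum>i<n. 1 / real (Suc i) powr x)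
          (\<lambda>x. \<Sum>i. 1 / real (Suc i) powr x) sequentially"
  proof (rule Weierstrass_m_test)
    fix n x assume "x \<in> {s..}"
    then show "norm (1 / real (Suc n) powr x) \<le> 1 / real (Suc n) powr s"
      by (auto intro!: divide_left_mono powr_mono)
  qed (rule zeta_real_summable[OF assms])
  then have "continuous_on {s..} (\<lambda>x. \<Sum>i. 1 / real (Suc i) powr x)"
    by (rule uniform_limit_theorem[rotated]) (auto intro!: always_eventually continuous_intros)
  then show ?thesis unfolding zeta_real_def .
qed

lemma zeta_real_2_le: "zeta_real 2 \<le> 2"
proof -
  have "(\<Sum>n. 1 / real (Suc n) powr 2) \<le> 2"
  proof (rule suminf_le_const[OF zeta_real_summable])
    fix n
    have partial: "(\<Sum>i<n. 1 / real (Suc i) powr 2) \<le> 2 - 1 / real n" if "1 \<le> n" for n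
      using that
    proof (induction n rule: nat_induct_at_least)
      case (Suc n)
      have "1 / real (Suc n) powr 2 = 1 / (real (Suc n) * real (Suc n))"
        by (simp add: power2_eq_square)
      also have "\<dots> \<le> 1 / (real n * real (Suc n))"
        using Suc.hyps by (intro divide_left_mono mult_right_mono) auto
      also have "\<dots> = 1 / real n - 1 / real (Suc n)"
        using Suc.hyps by (simp add: field_simps)
      finally have "1 / real (Suc n) powr 2 \<le> 1 / real n - 1 / real (Suc n)" .
      with Suc show ?case by simp
    qed auto
    show "(\<Sum>i<n. 1 / real (Suc i) powr 2) \<le> 2"
    proof (cases "n = 0")
      case False
      then have "(\<Sum>i<n. 1 / real (Suc i) powr 2) \<le> 2 - 1 / real n" by (intro partial) simp
      also have "\<dots> \<le> 2" by simp
      finally show ?thesis .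
    qed simp
  qed auto
  then show ?thesis by (simp add: zeta_real_def)
qed

text \<open>
  The partial sum \<open>1 + 1/2 + 1/3 + 1/4\<close> already exceeds \<open>2\<close>, so four terms suffice near \<open>s = 1\<close>.
\<close>

lemma zeta_real_large: "\<exists>s. 1 < s \<and> s < 2 \<and> 2 < zeta_real s"
proof -
  let ?g = "\<lambda>x::real. \<Sum>i<4. 1 / real (Suc i) powr x"
  have "isCont ?g 1" by (intro continuous_intros) auto
  then have "(?g \<longlongrightarrow> ?g 1) (at_right 1)" 
    by (simp add: isCont_def filterlim_at_split)
  moreover have "?g 1 > 2" by (simp add: eval_nat_numeral)
  ultimately have "eventually (\<lambda>x. ?g x > 2) (at_right 1)"
    by (simp add: order_tendsto_iff)
  moreover have "eventually (\<lambda>x::real. x \<in> {1<..<2}) (at_right 1)"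
    by (rule eventually_at_right_real) auto
  ultimately obtain s where s: "?g s > 2" "s \<in> {1<..<2}"
    using eventually_happens'[OF _ eventually_conj] by (metis (no_types, lifting) trivial_limit_at_right_real)
  have "?g s \<le> zeta_real s"
    unfolding zeta_real_def by (rule sum_le_suminf[OF zeta_real_summable]) (use s in auto)
  then show ?thesis using s by auto
qed

lemma kalmar_rho: "1 < kalmar_rho" "zeta_real kalmar_rho = 2"
proof -
  obtain s where s: "1 < s" "s < 2" "2 < zeta_real s" using zeta_real_large by blast
  have "\<exists>r\<ge>s. r \<le> 2 \<and> zeta_real r = 2"
    by (rule IVT2') (use s zeta_real_2_le zeta_real_continuous[OF s(1)] 
       in \<open>auto intro: continuous_on_subset\<close>)
  then obtain r where r: "1 < r \<and> zeta_real r = 2" using s by force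
  have "1 < kalmar_rho \<and> zeta_real kalmar_rho = 2"
    unfolding kalmar_rho_def
  proof (rule theI[where P = "\<lambda>r. 1 < r \<and> zeta_real r = 2", OF r])
    fix t assume "1 < t \<and> zeta_real t = 2"
    with r show "t = r" 
      using zeta_real_strict_antimono[of r t] zeta_real_strict_antimono[of t r]
      by (cases r t rule: linorder_cases) auto
  qed
  then show "1 < kalmar_rho" "zeta_real kalmar_rho = 2" by auto
qed

section \<open>Additive functions averaged against the weights m to the power minus rho\<close>

lemma powr_summable_on:
  assumes "1 < s"
  shows "(\<lambda>m::nat. real m powr (-s)) summable_on {1..}"
proof -
  have "(\<lambda>n. 1 / real (Suc n) powr s) sums (\<Sum>n. 1 / real (Suc n) powr s)"
    by (rule summable_sums[OF zeta_real_summable[OF assms]])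
  then have "((\<lambda>m. real m powr (-s)) has_sum (\<Sum>n. 1 / real (Suc n) powr s)) {1..}"
    by (intro has_sum_from_1) (simp_all add: powr_minus field_simps)
  then show ?thesis by (rule has_sum_imp_summable)
qed

text \<open>
  The logarithms are absorbed by a power \<open>m powr (k * e)\<close> with \<open>k * e\<close> at most half of \<open>s - 1\<close>.
\<close>

lemma ln_power_powr_summable_on:
  assumes "1 < s"
  shows "(\<lambda>m::nat. real m powr (-s) * ln (real m) ^ k) summable_on {1..}"
proof (rule summable_on_comparison_test)
  define e where "e = (s - 1) / (2 * (real k + 1))"
  have e: "0 < e" using assms by (simp add: e_def)
  have "real k * e \<le> (real k + 1) * e" using e by (intro mult_right_mono) auto
  also have "\<dots> = (s - 1) / 2"
    by (simp add: e_def divide_simps add_nonneg_eq_0_iff)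
  finally have ke: "real k * e \<le> (s - 1) / 2" .
  show "(\<lambda>m::nat. (1 / e ^ k) * real m powr (-(s - real k * e))) summable_on {1..}"
    using ke assms by (intro summable_on_cmult_right powr_summable_on) (simp add: field_simps)
  fix m :: nat assume "m \<in> {1..}"
  then have m: "1 \<le> real m" by simp
  then have "ln (real m) ^ k \<le> (real m powr e / e) ^ k"
    using e by (intro power_mono ln_powr_bound) auto
  also have "\<dots> = real m powr (real k * e) / e ^ k"
    using m by (simp add: power_divide powr_power mult.commute)
  finally have "real m powr (-s) * ln (real m) ^ k
      \<le> real m powr (-s) * (real m powr (real k * e) / e ^ k)"
    by (intro mult_left_mono) auto
  also have "\<dots> = (1 / e ^ k) * real m powr (-(s - real k * e))"
    by (simp add: powr_add[symmetric])
  finally show "real m powr (-s) * ln (real m) ^ k \<le> (1 / e ^ k) * real m powr (-(s - real k * e))" .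
qed auto

text \<open>
  The term \<open>m = 1\<close> contributes \<open>1\<close>; so the weights of the possible factors \<open>m \<ge> 2\<close> have sum
  exactly \<open>1\<close>, which is what makes \<open>\<rho>\<close> the critical exponent.
\<close>

lemma rho_has_sum: "((\<lambda>m::nat. real m powr (-kalmar_rho)) has_sum 2) {1..}"
proof -
  have "(\<lambda>n. 1 / real (Suc n) powr kalmar_rho) sums 2"
    using summable_sums[OF zeta_real_summable[OF kalmar_rho(1)]] kalmar_rho(2)
    by (simp add: zeta_real_def)
  then show ?thesis
    by (intro has_sum_from_1) (simp_all add: powr_minus field_simps)
qed

text \<open>
  For \<open>h\<close> equal to \<open>1\<close>, to \<open>ln\<close>, and to a multiple of the indicator function of one prime, this is \<open>\<Omega>\<close>,
  \<open>ln\<close>, and a multiple of the multiplicity of that prime; one estimate covers all of them.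
\<close>

definition additive_ext :: "(nat \<Rightarrow> real) \<Rightarrow> nat \<Rightarrow> real" where
  "additive_ext h m = (\<Sum>p\<in>prime_factors m. real (multiplicity p m) * h p)"

lemma additive_ext_superset:
  assumes "finite A" "prime_factors m \<subseteq> A" "\<And>p. p \<in> A \<Longrightarrow> prime p" "1 \<le> m"
  shows "additive_ext h m = (\<Sum>p\<in>A. real (multiplicity p m) * h p)"
  unfolding additive_ext_def
proof (rule sum.mono_neutral_left[OF assms(1,2)], safe)
  fix p assume "p \<in> A" "p \<notin> prime_factors m"
  then have "\<not> p dvd m" using assms by (auto simp: prime_factors_dvd)
  then show "real (multiplicity p m) * h p = 0" by (simp add: not_dvd_imp_multiplicity_0)
qed

lemma additive_ext_mult:
  assumes "1 \<le> m" "1 \<le> n"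
  shows "additive_ext h (m * n) = additive_ext h m + additive_ext h n"
proof -
  let ?A = "prime_factors m \<union> prime_factors n"
  have "prime_factors (m * n) = ?A"
    using assms by (simp add: prime_factorization_mult)
  then have "additive_ext h (m * n) = (\<Sum>p\<in>?A. real (multiplicity p (m * n)) * h p)"
    by (simp add: additive_ext_def)
  also have "\<dots> = (\<Sum>p\<in>?A. real (multiplicity p m) * h p + real (multiplicity p n) * h p)"
    by (rule sum.cong)
      (use assms in \<open>auto simp: prime_elem_multiplicity_mult_distrib in_prime_factors_iff algebra_simps\<close>)
  also have "\<dots> = (\<Sum>p\<in>?A. real (multiplicity p m) * h p) + (\<Sum>p\<in>?A. real (multiplicity p n) * h p)"
    by (rule sum.distrib)
  also have "(\<Sum>p\<in>?A. real (multiplicity p m) * h p) = additive_ext h m"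
    by (rule additive_ext_superset[symmetric]) (use assms in auto)
  also have "(\<Sum>p\<in>?A. real (multiplicity p n) * h p) = additive_ext h n"
    by (rule additive_ext_superset[symmetric]) (use assms in auto)
  finally show ?thesis .
qed

lemma additive_ext_ln: "1 \<le> m \<Longrightarrow> additive_ext (\<lambda>p. ln (real p)) m = ln (real m)"
proof -
  assume m: "1 \<le> m"
  then have "real m = real (\<Prod>p\<in>prime_factors m. p ^ multiplicity p m)"
    by (subst prod_prime_factors) auto
  then have "ln (real m) = ln (\<Prod>p\<in>prime_factors m. real p ^ multiplicity p m)" by simp
  also have "\<dots> = (\<Sum>p\<in>prime_factors m. ln (real p ^ multiplicity p m))"
    by (subst ln_prod) (auto simp: in_prime_factors_iff prime_gt_0_nat)
  also have "\<dots> = additive_ext (\<lambda>p. ln (real p)) m"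
    unfolding additive_ext_def
    by (intro sum.cong) (auto simp: in_prime_factors_iff prime_gt_0_nat ln_realpow)
  finally show ?thesis by simp
qed

lemma additive_ext_Omega: "additive_ext (\<lambda>_. 1) m = real (prime_Omega m)"
proof -
  have "size (prime_factorization m) = (\<Sum>p\<in>prime_factors m. multiplicity p m)"
    unfolding size_multiset_overloaded_eq
    by (intro sum.cong) (auto simp: count_prime_factorization in_prime_factors_iff)
  then show ?thesis by (simp add: additive_ext_def prime_Omega_def)
qed

lemma additive_ext_single:
  assumes "prime p" "1 \<le> m"
  shows "additive_ext (\<lambda>q. if q = p then c else 0) m = real (multiplicity p m) * c"
proof (cases "p dvd m")
  case True
  then have "p \<in> prime_factors m" using assms by (simp add: prime_factors_dvd)
  have "additive_ext (\<lambda>q. if q = p then c else 0) m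
      = (\<Sum>q\<in>prime_factors m. if q = p then real (multiplicity q m) * c else 0)"
    unfolding additive_ext_def by (intro sum.cong) auto
  also have "\<dots> = real (multiplicity p m) * c"
    using \<open>p \<in> prime_factors m\<close> by simp
  finally show ?thesis .
next
  case False
  then have "p \<notin> prime_factors m" by auto
  then show ?thesis
    unfolding additive_ext_def
    by (subst sum.neutral) (auto simp: not_dvd_imp_multiplicity_0[OF False])
qed

lemma additive_ext_le:
  assumes "\<And>p. prime p \<Longrightarrow> h p \<le> B * ln (real p)" "1 \<le> m"
  shows "additive_ext h m \<le> B * ln (real m)"
proof -
  have "additive_ext h m \<le> (\<Sum>p\<in>prime_factors m. real (multiplicity p m) * (B * ln (real p)))"
    unfolding additive_ext_def
    by (intro sum_mono mult_left_mono assms) auto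
  also have "\<dots> = B * additive_ext (\<lambda>p. ln (real p)) m"
    by (simp add: additive_ext_def sum_distrib_left mult_ac)
  also have "\<dots> = B * ln (real m)" by (subst additive_ext_ln[OF assms(2)]) simp
  finally show ?thesis .
qed

text \<open>
  Only multiples of \<open>p\<close> contribute to the sum \<open>V\<close>, and passing from \<open>m\<close> to \<open>p * m\<close> raises the
  multiplicity by one; hence \<open>V = p powr -\<rho> * (2 + V)\<close>. This replaces the Euler product.
\<close>

lemma multiplicity_has_sum:
  assumes p: "prime p"
  shows "((\<lambda>m::nat. real m powr (-kalmar_rho) * real (multiplicity p m))
            has_sum (2 / (real p powr kalmar_rho - 1))) {1..}"
proof -
  let ?f = "\<lambda>m::nat. real m powr (-kalmar_rho) * real (multiplicity p m)"
  have p2: "1 < real p" using prime_gt_1_nat[OF p] by simp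
  have mult_le: "real (multiplicity p m) \<le> ln (real m) / ln (real p)" if m: "1 \<le> m" for m
  proof -
    have "additive_ext (\<lambda>q. if q = p then ln (real p) else 0) m \<le> 1 * ln (real m)"
      by (rule additive_ext_le[OF _ m]) (auto dest: prime_ge_1_nat)
    then show ?thesis
      using p2 by (simp add: additive_ext_single[OF p m] field_simps)
  qed
  have f: "?f summable_on {1..}"
  proof (rule summable_on_comparison_test)
    show "(\<lambda>m::nat. (real m powr (-kalmar_rho) * ln (real m) ^ 1) * (1 / ln (real p))) summable_on {1..}"
      by (intro summable_on_cmult_left ln_power_powr_summable_on kalmar_rho)
    fix m :: nat assume "m \<in> {1..}"
    then show "?f m \<le> (real m powr (-kalmar_rho) * ln (real m) ^ 1) * (1 / ln (real p))"
      using mult_left_mono[OF mult_le[of m], of "real m powr (-kalmar_rho)"] by simp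
  qed auto
  define V where "V = infsum ?f {1..}"
  have V: "(?f has_sum V) {1..}" using f by (simp add: V_def)
  have "((\<lambda>m::nat. real p powr (-kalmar_rho) * (real m powr (-kalmar_rho) + ?f m)) 
           has_sum (real p powr (-kalmar_rho) * (2 + V))) {1..}"
    by (intro has_sum_cmult_right has_sum_add rho_has_sum V)
  also have "?this \<longleftrightarrow> ((\<lambda>m. ?f (p * m)) has_sum (real p powr (-kalmar_rho) * (2 + V))) {1..}"
  proof (intro has_sum_cong)
    fix m :: nat assume m: "m \<in> {1..}"
    have "multiplicity p (p * m) = Suc (multiplicity p m)"
      using p2 m by (intro multiplicity_times_same) auto
    then show "real p powr (-kalmar_rho) * (real m powr (-kalmar_rho) + ?f m) = ?f (p * m)"
      by (simp add: powr_mult algebra_simps)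
  qed
  also have "\<dots> \<longleftrightarrow> (?f has_sum (real p powr (-kalmar_rho) * (2 + V))) ((*) p ` {1..})"
    by (subst has_sum_reindex) (use p2 in \<open>auto simp: inj_on_def o_def\<close>)
  also have "\<dots> \<longleftrightarrow> (?f has_sum (real p powr (-kalmar_rho) * (2 + V))) {1..}"
  proof (rule has_sum_cong_neutral)
    fix m :: nat assume m: "m \<in> {1..} - (*) p ` {1..}"
    have "\<not> p dvd m"
    proof
      assume "p dvd m"
      then obtain k where "m = p * k" by auto
      with m show False by (cases "k = 0") auto
    qed
    then show "?f m = 0" by (simp add: not_dvd_imp_multiplicity_0)
  next
    fix m :: nat assume "m \<in> (*) p ` {1..} - {1..}"
    then show "?f m = 0" using p2 by (cases "m = 0") auto
  qed auto
  finally have fixpoint: "V = real p powr (-kalmar_rho) * (2 + V)"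
    using has_sum_unique V by blast
  have pr: "1 < real p powr kalmar_rho"
    using p2 kalmar_rho(1) by simp
  then have "V * real p powr kalmar_rho = 2 + V"
    using p2 by (subst fixpoint) (simp add: powr_minus)
  then have "V = 2 / (real p powr kalmar_rho - 1)"
    using pr by (simp add: eq_divide_eq algebra_simps)
  with V show ?thesis by simp
qed

text \<open>
  The double sum over \<open>m\<close> and \<open>p\<close> of \<open>m powr -\<rho> * (multiplicity p m * h p)\<close> has nonnegative terms, so
  it may be evaluated in either order; the inner sum over \<open>m\<close> is \<open>multiplicity_has_sum\<close>.
\<close>

lemma additive_ext_has_sum:
  assumes h: "\<And>p. prime p \<Longrightarrow> 0 \<le> h p" "\<And>p. prime p \<Longrightarrow> h p \<le> B * ln (real p)"
  obtains S where "((\<lambda>p. h p / (real p powr kalmar_rho - 1)) has_sum S) {p. prime p}"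
    and "((\<lambda>m::nat. real m powr (-kalmar_rho) * additive_ext h m) has_sum (2 * S)) {1..}"
proof -
  let ?f = "\<lambda>(m::nat, p). real m powr (-kalmar_rho) * (real (multiplicity p m) * h p)"
  let ?g = "\<lambda>m::nat. real m powr (-kalmar_rho) * additive_ext h m"
  have nonneg: "0 \<le> additive_ext h m" for m
    unfolding additive_ext_def by (intro sum_nonneg) (auto simp: in_prime_factors_iff h(1))
  have g: "?g summable_on {1..}"
  proof (rule summable_on_comparison_test)
    show "(\<lambda>m::nat. (real m powr (-kalmar_rho) * ln (real m) ^ 1) * B) summable_on {1..}"
      by (intro summable_on_cmult_left ln_power_powr_summable_on kalmar_rho)
    fix m :: nat assume "m \<in> {1..}"
    then have "additive_ext h m \<le> B * ln (real m)" by (intro additive_ext_le h) auto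
    then have "?g m \<le> real m powr (-kalmar_rho) * (B * ln (real m))" by (intro mult_left_mono) auto
    then show "?g m \<le> (real m powr (-kalmar_rho) * ln (real m) ^ 1) * B" by (simp add: mult_ac)
  qed (use nonneg in auto)
  have rows: "((\<lambda>p. ?f (m, p)) has_sum ?g m) {p. prime p}" if "m \<in> {1..}" for m
  proof (rule has_sum_finite_neutralI[of "prime_factors m"])
    fix p assume "p \<in> {p. prime p} - prime_factors m"
    then have "\<not> p dvd m" using that by (auto simp: prime_factors_dvd)
    then show "?f (m, p) = 0" by (simp add: not_dvd_imp_multiplicity_0)
  qed (auto simp: additive_ext_def sum_distrib_left in_prime_factors_iff)
  have "?f summable_on ({1..} \<times> {p. prime p})"
    by (rule summable_on_SigmaI[OF rows g]) (auto simp: h(1))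
  then obtain T where T: "(?f has_sum T) ({1..} \<times> {p. prime p})"
    by (auto simp: summable_on_def)
  have "(?g has_sum T) {1..}" by (rule has_sum_SigmaD[OF T rows])
  moreover have "((\<lambda>p. h p * (2 / (real p powr kalmar_rho - 1))) has_sum T) {p. prime p}"
  proof (rule has_sum_SigmaD)
    show "((\<lambda>(p, m). ?f (m, p)) has_sum T) ({p. prime p} \<times> {1..})"
      using T by (subst (asm) has_sum_swap)
    fix p :: nat assume "p \<in> {p. prime p}"
    then have "((\<lambda>m. h p * (real m powr (-kalmar_rho) * real (multiplicity p m)))
       has_sum (h p * (2 / (real p powr kalmar_rho - 1)))) {1..}"
      by (intro has_sum_cmult_right multiplicity_has_sum) auto
    then show "((\<lambda>m. (\<lambda>(p, m). ?f (m, p)) (p, m)) has_sum (h p * (2 / (real p powr kalmar_rho - 1)))) {1..}"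
      by (simp add: mult_ac)
  qed
  then have "((\<lambda>p. (1 / 2) * (h p * (2 / (real p powr kalmar_rho - 1)))) has_sum ((1 / 2) * T)) {p. prime p}"
    by (rule has_sum_cmult_right)
  then have "((\<lambda>p. h p / (real p powr kalmar_rho - 1)) has_sum (T / 2)) {p. prime p}" by simp
  ultimately show ?thesis by (intro that[of "T / 2"]) auto
qed

lemma nth_pr_bij: "bij_betw (\<lambda>i. nth_pr (Suc i)) UNIV {p. prime p}"
  unfolding nth_pr_def using bij_enumerate[of "{p::nat. prime p}"] primes_infinite by simp

lemma suminf_nth_pr:
  fixes f :: "nat \<Rightarrow> real"
  assumes "(f has_sum S) {p. prime p}"
  shows "(\<Sum>i. f (nth_pr (Suc i))) = S"
proof -
  have "((\<lambda>i. f (nth_pr (Suc i))) has_sum S) UNIV"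
    using assms has_sum_reindex_bij_betw[OF nth_pr_bij, of f S] by simp
  then show ?thesis by (intro sums_unique[symmetric] has_sum_imp_sums)
qed

text \<open>
  Since the additive extension of \<open>ln\<close> is \<open>ln\<close> itself, the series over the primes that defines \<open>a\<close> is
  half of \<open>- \<zeta>'(\<rho>)\<close>.
\<close>

lemma kalmar_a_has_sum:
  shows "0 < kalmar_a"
    and "((\<lambda>m::nat. real m powr (-kalmar_rho) * ln (real m)) has_sum (2 / kalmar_a)) {1..}"
proof -
  obtain S where S: "((\<lambda>p. ln (real p) / (real p powr kalmar_rho - 1)) has_sum S) {p. prime p}"
    and S2: "((\<lambda>m::nat. real m powr (-kalmar_rho) * additive_ext (\<lambda>p. ln (real p)) m) has_sum (2 * S)) {1..}"
    by (rule additive_ext_has_sum[of "\<lambda>p. ln (real p)" 1]) (auto dest: prime_ge_1_nat)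
  have a: "kalmar_a = 1 / S"
    unfolding kalmar_a_def using suminf_nth_pr[OF S] by simp
  have "((\<lambda>m::nat. real m powr (-kalmar_rho) * ln (real m)) has_sum (2 * S)) {1..} \<longleftrightarrow>
    ((\<lambda>m::nat. real m powr (-kalmar_rho) * additive_ext (\<lambda>p. ln (real p)) m) has_sum (2 * S)) {1..}"
    by (intro has_sum_cong) (simp add: additive_ext_ln)
  with S2 have S3: "((\<lambda>m::nat. real m powr (-kalmar_rho) * ln (real m)) has_sum (2 * S)) {1..}" by simp
  then show "((\<lambda>m::nat. real m powr (-kalmar_rho) * ln (real m)) has_sum (2 / kalmar_a)) {1..}"
    by (simp add: a)
  have "(\<Sum>m\<in>{2::nat}. real m powr (-kalmar_rho) * ln (real m)) \<le> 2 * S"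
    by (rule finite_sum_le_has_sum[OF S3]) auto
  then have "2 powr (-kalmar_rho) * ln 2 \<le> 2 * S" by simp
  moreover have "0 < (2::real) powr (-kalmar_rho) * ln 2" by simp
  ultimately have "0 < S" by linarith
  then show "0 < kalmar_a" by (simp add: a)
qed

section \<open>The tilted upper bound\<close>

lemma exp_le_quadratic: "exp t \<le> 1 + t + t\<^sup>2 * exp \<bar>t\<bar>" for t :: real
proof -
  obtain u where u: "\<bar>u\<bar> \<le> \<bar>t\<bar>" "exp t = (\<Sum>m<2. t ^ m / fact m) + exp u / fact 2 * t\<^sup>2"
    using Maclaurin_exp_le[of t 2] by blast
  have "exp u / fact 2 * t\<^sup>2 \<le> exp \<bar>t\<bar> * t\<^sup>2"
  proof (rule mult_right_mono)
    have "exp u \<le> exp \<bar>t\<bar>" using u(1) by simp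
    moreover have "exp u / fact 2 \<le> exp u" by (simp add: fact_2)
    ultimately show "exp u / fact 2 \<le> exp \<bar>t\<bar>" by linarith
  qed simp
  then show ?thesis using u(2) by (simp add: eval_nat_numeral mult.commute)
qed

text \<open>
  The tilted weight is \<open>m powr -\<rho> * exp (t m)\<close> with \<open>t m = x * G m - C * x\<^sup>2 * ln m\<close>. In
  \<open>exp t \<le> 1 + t + t\<^sup>2 * exp \<bar>t\<bar>\<close> the linear part sums to \<open>- C * x\<^sup>2 * P\<close>, because \<open>G\<close> is orthogonal to \<open>m powr -\<rho>\<close>, and
  the quadratic part to at most \<open>25 * x\<^sup>2 * Q\<close>; so \<open>C = 25 * Q / P\<close> keeps the total weight at most that
  for \<open>x = 0\<close>. The constants depend only on the factor \<open>4\<close> in the bound for \<open>G\<close>, not on \<open>G\<close>: the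
  uniformity in \<open>i\<close> of the final estimate rests on this.
\<close>

lemma kalmar_K_tilted_bound:
  obtains C x0 :: real where "0 < x0"
    and "\<And>G x n. \<lbrakk>\<And>m n. 1 \<le> m \<Longrightarrow> 1 \<le> n \<Longrightarrow> G (m * n) = G m + G n;
           \<And>m. 1 \<le> m \<Longrightarrow> \<bar>G m\<bar> \<le> 4 * ln (real m);
           ((\<lambda>m::nat. real m powr (-kalmar_rho) * G m) has_sum 0) {1..}; \<bar>x\<bar> \<le> x0; 1 \<le> n\<rbrakk> \<Longrightarrow>
           ln (real (kalmar_K n)) \<le> kalmar_rho * ln (real n) - x * G n + C * x\<^sup>2 * ln (real n)"
proof -
  define e where "e = (kalmar_rho - 1) / 2"
  have e: "0 < e" "1 < kalmar_rho - e" using kalmar_rho(1) by (auto simp: e_def field_simps)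
  obtain Q where Q: "((\<lambda>m::nat. real m powr (-(kalmar_rho - e)) * ln (real m) ^ 2) has_sum Q) {1..}"
    using ln_power_powr_summable_on[OF e(2), of 2] by (auto simp: summable_on_def)
  have "0 \<le> Q" by (rule has_sum_nonneg[OF Q]) auto
  define P where "P = 2 / kalmar_a"
  have P: "0 < P" "((\<lambda>m::nat. real m powr (-kalmar_rho) * ln (real m)) has_sum P) {1..}"
    using kalmar_a_has_sum by (auto simp: P_def)
  define C where "C = 25 * Q / P"
  have C: "0 \<le> C" using P \<open>0 \<le> Q\<close> by (simp add: C_def)
  \<comment> \<open>The first bound ensures \<open>C * x\<^sup>2 \<le> \<bar>x\<bar>\<close>, the second \<open>\<bar>t m\<bar> \<le> e * ln m\<close>.\<close>
  define x0 where "x0 = min (1 / (C + 1)) (e / 5)"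
  have x0: "0 < x0" using C e by (simp add: x0_def)
  show thesis
  proof (rule that[OF x0])
    fix G :: "nat \<Rightarrow> real" and x :: real and n :: nat
    assume add: "\<And>m n. 1 \<le> m \<Longrightarrow> 1 \<le> n \<Longrightarrow> G (m * n) = G m + G n"
      and G_le: "\<And>m. 1 \<le> m \<Longrightarrow> \<bar>G m\<bar> \<le> 4 * ln (real m)"
      and G0: "((\<lambda>m::nat. real m powr (-kalmar_rho) * G m) has_sum 0) {1..}"
      and x: "\<bar>x\<bar> \<le> x0" and n: "1 \<le> n"
    define t where "t m = x * G m - C * x\<^sup>2 * ln (real m)" for m
    define w where "w m = real m powr (-kalmar_rho) * exp (t m)" for m
    \<comment> \<open>A majorant of \<open>w\<close> whose sum is known exactly.\<close>
    define F where "F m = real m powr (-kalmar_rho) + x * (real m powr (-kalmar_rho) * G m)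
        + (-C * x\<^sup>2) * (real m powr (-kalmar_rho) * ln (real m))
        + (25 * x\<^sup>2) * (real m powr (-(kalmar_rho - e)) * ln (real m) ^ 2)" for m
    have "G 1 = 0" using add[of 1 1] by simp
    have total: "(F has_sum (2 + x * 0 + (-C * x\<^sup>2) * P + (25 * x\<^sup>2) * Q)) {1..}"
      unfolding F_def by (intro has_sum_add has_sum_cmult_right rho_has_sum G0 P(2) Q)
    have total_eq: "2 + x * 0 + (-C * x\<^sup>2) * P + (25 * x\<^sup>2) * Q = 2"
      using P(1) by (simp add: C_def)
    have F_sum: "(F has_sum 2) {1..}" using total unfolding total_eq .
    have t_abs: "\<bar>t m\<bar> \<le> 5 * \<bar>x\<bar> * ln (real m)" if "1 \<le> m" for m
    proof -
      have "C * \<bar>x\<bar> \<le> (C + 1) * (1 / (C + 1))"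
        using x C by (intro mult_mono) (auto simp: x0_def)
      then have Cx: "C * \<bar>x\<bar> \<le> 1" using C by simp
      have L: "0 \<le> ln (real m)" using that by simp
      have "\<bar>t m\<bar> \<le> \<bar>x * G m\<bar> + \<bar>C * x\<^sup>2 * ln (real m)\<bar>"
        unfolding t_def by (rule abs_triangle_ineq4)
      also have "\<bar>x * G m\<bar> = \<bar>x\<bar> * \<bar>G m\<bar>" by (rule abs_mult)
      also have "\<dots> \<le> \<bar>x\<bar> * (4 * ln (real m))"
        using G_le that by (intro mult_left_mono) auto
      also have "\<bar>C * x\<^sup>2 * ln (real m)\<bar> = (C * \<bar>x\<bar>) * (\<bar>x\<bar> * ln (real m))"
        using C L by (simp add: abs_mult power2_eq_square)
      also have "\<dots> \<le> 1 * (\<bar>x\<bar> * ln (real m))"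
        using Cx L by (intro mult_right_mono) auto
      finally show ?thesis by (simp add: algebra_simps)
    qed
    have w_le: "w m \<le> F m" if m: "1 \<le> m" for m
    proof -
      have "5 * \<bar>x\<bar> \<le> e" using x by (auto simp: x0_def)
      then have "\<bar>t m\<bar> \<le> e * ln (real m)"
        using t_abs[OF m] mult_right_mono[of "5 * \<bar>x\<bar>" e "ln (real m)"] m by simp
      then have "exp \<bar>t m\<bar> \<le> real m powr e" using m by (simp add: powr_def)
      moreover have "(t m)\<^sup>2 \<le> (5 * \<bar>x\<bar> * ln (real m))\<^sup>2"
        using power_mono[OF t_abs[OF m], of 2] by simp
      ultimately have "(t m)\<^sup>2 * exp \<bar>t m\<bar> \<le> (5 * \<bar>x\<bar> * ln (real m))\<^sup>2 * real m powr e"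
        by (intro mult_mono) auto
      then have "exp (t m) \<le> 1 + t m + 25 * x\<^sup>2 * (ln (real m))\<^sup>2 * real m powr e"
        using exp_le_quadratic[of "t m"] by (simp add: power_mult_distrib)
      then have "w m \<le> real m powr (-kalmar_rho) * (1 + t m + 25 * x\<^sup>2 * (ln (real m))\<^sup>2 * real m powr e)"
        unfolding w_def by (intro mult_left_mono) auto
      also have "\<dots> = F m"
      proof -
        have "real m powr (-(kalmar_rho - e)) = real m powr (-kalmar_rho) * real m powr e"
          by (simp add: powr_add[symmetric])
        then show ?thesis by (simp only: F_def t_def) (simp add: algebra_simps)
      qed
      finally show ?thesis .
    qed
    have "real (kalmar_K n) * w n \<le> 1"
    proof (rule kalmar_K_weight_le[OF _ _ _ _ n])
      show "w 1 = 1" using \<open>G 1 = 0\<close> by (simp add: w_def t_def)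
      show "w (m * k) = w m * w k" if "1 \<le> m" "1 \<le> k" for m k
      proof -
        have "t (m * k) = t m + t k"
          using that add by (simp add: t_def ln_mult algebra_simps)
        then show ?thesis by (simp add: w_def powr_mult exp_add)
      qed
      show "sum w {2..k} \<le> 1" for k
      proof (cases "1 \<le> k")
        case True
        then have "{1..k} = insert 1 {2..k}" by auto
        then have "1 + sum w {2..k} = sum w {1..k}" using \<open>w 1 = 1\<close> by simp
        also have "\<dots> \<le> sum F {1..k}" by (rule sum_mono) (use w_le in auto)
        also have "\<dots> \<le> 2"
        proof (rule finite_sum_le_has_sum[OF F_sum])
          fix m :: nat assume "m \<in> {1..} - {1..k}"
          then have "0 \<le> w m" "w m \<le> F m" using w_le by (auto simp: w_def)
          then show "0 \<le> F m" by simp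
        qed auto
        finally show ?thesis by simp
      qed auto
    qed (auto simp: w_def)
    moreover have K: "0 < real (kalmar_K n)" using kalmar_K_pos[OF n] by simp
    moreover have w: "0 < w n" using n by (simp add: w_def)
    ultimately have "ln (real (kalmar_K n) * w n) \<le> 0"
      by simp
    moreover have "ln (w n) = - kalmar_rho * ln (real n) + t n"
      using n by (simp add: w_def ln_mult ln_powr)
    ultimately show "ln (real (kalmar_K n)) \<le> kalmar_rho * ln (real n) - x * G n + C * x\<^sup>2 * ln (real n)"
      using K w by (simp add: ln_mult t_def)
  qed
qed

text \<open>
  The function \<open>additive_ext h m - a * S * ln m\<close> is orthogonal to \<open>m powr -\<rho>\<close>, since
  the sums for \<open>additive_ext h\<close> and \<open>ln\<close> are \<open>2 * S\<close> and \<open>2 / a\<close>; and \<open>0 \<le> a * S \<le> 2\<close> because \<open>additive_ext h \<le> 2 * ln\<close>.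
\<close>

lemma kalmar_K_additive_bound:
  obtains C x0 :: real where "0 < x0"
    and "\<And>h S x n. \<lbrakk>\<And>p. prime p \<Longrightarrow> 0 \<le> h p \<and> h p \<le> 2 * ln (real p);
           ((\<lambda>p. h p / (real p powr kalmar_rho - 1)) has_sum S) {p. prime p}; \<bar>x\<bar> \<le> x0; 1 \<le> n\<rbrakk> \<Longrightarrow>
           ln (real (kalmar_K n)) \<le> kalmar_rho * ln (real n)
             - x * (additive_ext h n - kalmar_a * S * ln (real n)) + C * x\<^sup>2 * ln (real n)"
proof (rule kalmar_K_tilted_bound)
  fix C x0 :: real
  assume x0: "0 < x0" and bound: "\<And>G x n. \<lbrakk>\<And>m n. 1 \<le> m \<Longrightarrow> 1 \<le> n \<Longrightarrow> G (m * n) = G m + G n;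
     \<And>m. 1 \<le> m \<Longrightarrow> \<bar>G m\<bar> \<le> 4 * ln (real m);
     ((\<lambda>m::nat. real m powr (-kalmar_rho) * G m) has_sum 0) {1..}; \<bar>x\<bar> \<le> x0; 1 \<le> n\<rbrakk> \<Longrightarrow>
        ln (real (kalmar_K n)) \<le> kalmar_rho * ln (real n) - x * G n + C * x\<^sup>2 * ln (real n)"
  have a: "0 < kalmar_a" by (rule kalmar_a_has_sum)
  show thesis
  proof (rule that[OF x0])
    fix h :: "nat \<Rightarrow> real" and S x :: real and n :: nat
    assume h: "\<And>p. prime p \<Longrightarrow> 0 \<le> h p \<and> h p \<le> 2 * ln (real p)"
      and S: "((\<lambda>p. h p / (real p powr kalmar_rho - 1)) has_sum S) {p. prime p}"
      and x: "\<bar>x\<bar> \<le> x0" and n: "1 \<le> n"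
    obtain S' where "((\<lambda>p. h p / (real p powr kalmar_rho - 1)) has_sum S') {p. prime p}"
      and H': "((\<lambda>m::nat. real m powr (-kalmar_rho) * additive_ext h m) has_sum (2 * S')) {1..}"
      using additive_ext_has_sum[of h 2] h by blast
    then have H: "((\<lambda>m::nat. real m powr (-kalmar_rho) * additive_ext h m) has_sum (2 * S)) {1..}"
      using has_sum_unique[OF S] by blast
    have h_nonneg: "0 \<le> additive_ext h m" for m
      unfolding additive_ext_def using h by (intro sum_nonneg) (auto simp: in_prime_factors_iff)
    have h_le: "additive_ext h m \<le> 2 * ln (real m)" if "1 \<le> m" for m
      using h that by (intro additive_ext_le) auto
    have "0 \<le> 2 * S" by (rule has_sum_nonneg[OF H]) (simp add: h_nonneg)
    have "2 * S \<le> 2 * (2 / kalmar_a)"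
    proof (rule has_sum_mono[OF H has_sum_cmult_right[OF kalmar_a_has_sum(2)]])
      fix m :: nat assume "m \<in> {1..}"
      then show "real m powr (-kalmar_rho) * additive_ext h m
          \<le> 2 * (real m powr (-kalmar_rho) * ln (real m))"
        using mult_left_mono[OF h_le[of m], of "real m powr (-kalmar_rho)"] by (simp add: mult_ac)
    qed
    then have aS: "0 \<le> kalmar_a * S" "kalmar_a * S \<le> 2"
      using a \<open>0 \<le> 2 * S\<close> by (auto simp: field_simps)
    define G where "G m = additive_ext h m - kalmar_a * S * ln (real m)" for m
    show "ln (real (kalmar_K n)) \<le> kalmar_rho * ln (real n)
          - x * (additive_ext h n - kalmar_a * S * ln (real n)) + C * x\<^sup>2 * ln (real n)"
    proof (rule bound[of G, unfolded G_def, OF _ _ _ x n])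
      fix m k :: nat assume "1 \<le> m" "1 \<le> k"
      then show "additive_ext h (m * k) - kalmar_a * S * ln (real (m * k))
         = additive_ext h m - kalmar_a * S * ln (real m) + (additive_ext h k - kalmar_a * S * ln (real k))"
        by (simp add: additive_ext_mult ln_mult algebra_simps)
    next
      fix m :: nat assume m: "1 \<le> m"
      then have "0 \<le> ln (real m)" by simp
      then have "0 \<le> kalmar_a * S * ln (real m)" "kalmar_a * S * ln (real m) \<le> 2 * ln (real m)"
        using aS by (auto intro: mult_right_mono)
      then show "\<bar>additive_ext h m - kalmar_a * S * ln (real m)\<bar> \<le> 4 * ln (real m)"
        using h_nonneg[of m] h_le[OF m] by linarith
    next
      have "((\<lambda>m::nat. real m powr (-kalmar_rho) * additive_ext h m
          + (- kalmar_a * S) * (real m powr (-kalmar_rho) * ln (real m)))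
          has_sum (2 * S + (- kalmar_a * S) * (2 / kalmar_a))) {1..}"
        by (intro has_sum_add has_sum_cmult_right H kalmar_a_has_sum)
      then show "((\<lambda>m::nat. real m powr (-kalmar_rho) *
          (additive_ext h m - kalmar_a * S * ln (real m))) has_sum 0) {1..}"
        using a by (simp add: algebra_simps)
    qed
  qed
qed

section \<open>Chebyshev's upper bound for the number of primes\<close>

definition chebyshev_theta :: "nat \<Rightarrow> real" where
  "chebyshev_theta n = (\<Sum>p | prime p \<and> p \<le> n. ln (real p))"

lemma finite_primes_le: "finite {p::nat. prime p \<and> p \<le> n}"
  by (rule finite_subset[of _ "{..n}"]) auto

lemma prod_primes_dvd:
  fixes n :: nat
  assumes "finite A" "\<And>p. p \<in> A \<Longrightarrow> prime p \<and> p dvd n"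
  shows "\<Prod>A dvd n"
  using assms
proof (induction A rule: finite_induct)
  case (insert p A)
  have "coprime p (\<Prod>A)"
    using insert by (intro prod_coprime_right primes_coprime) auto
  then show ?case using insert by (auto intro!: divides_mult)
qed auto

text \<open>
  The primes in \<open>((n + 1) div 2, n]\<close> divide the central binomial coefficient, which is at most \<open>2 ^ n\<close>.
\<close>

lemma chebyshev_theta_halve: "chebyshev_theta n \<le> chebyshev_theta ((n + 1) div 2) + real n * ln 2"
proof -
  let ?m = "(n + 1) div 2"
  let ?A = "{p. prime p \<and> ?m < p \<and> p \<le> n}"
  have fin: "finite ?A" by (rule finite_subset[OF _ finite_primes_le[of n]]) auto
  have "chebyshev_theta n = chebyshev_theta ?m + (\<Sum>p\<in>?A. ln (real p))"
    unfolding chebyshev_theta_def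
    by (subst sum.union_disjoint[symmetric]) (auto intro!: sum.cong finite_primes_le fin)
  also have "(\<Sum>p\<in>?A. ln (real p)) = ln (real (\<Prod>p\<in>?A. p))"
    using fin by (subst of_nat_prod, subst ln_prod) (auto simp: prime_gt_0_nat)
  also have "\<dots> \<le> ln (real (2 ^ n))"
  proof (subst ln_le_cancel_iff)
    have "(\<Prod>p\<in>?A. p) dvd (n choose ?m)"
    proof (rule prod_primes_dvd[OF fin])
      fix p assume "p \<in> ?A"
      then have p: "prime p" "?m < p" "p \<le> n" by auto
      have "fact ?m * fact (n - ?m) * (n choose ?m) = (fact n :: nat)"
        by (rule binomial_fact_lemma) auto
      moreover have "p dvd fact n" using p by (simp add: prime_dvd_fact_iff)
      moreover have "\<not> p dvd fact ?m" "\<not> p dvd fact (n - ?m)"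
        using p by (auto simp: prime_dvd_fact_iff)
      ultimately have "p dvd (n choose ?m)"
        using p(1) by (metis prime_dvd_mult_iff)
      with p(1) show "prime p \<and> p dvd (n choose ?m)" by simp
    qed
    moreover have "0 < (n choose ?m)" by (simp add: zero_less_binomial_iff) 
    ultimately have "(\<Prod>p\<in>?A. p) \<le> (n choose ?m)" by (rule dvd_imp_le)
    also have "\<dots> \<le> 2 ^ n" by (rule binomial_le_pow2)
    finally show "real (\<Prod>p\<in>?A. p) \<le> real (2 ^ n)" by (simp only: of_nat_le_iff)
    show "0 < real (\<Prod>p\<in>?A. p)" using fin by (auto intro!: prod_pos simp: prime_gt_0_nat)
  qed auto
  also have "ln (real (2 ^ n)) = real n * ln 2" by (simp add: ln_realpow)
  finally show ?thesis by simp
qed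

lemma chebyshev_theta_le: "chebyshev_theta n \<le> 4 * ln 2 * real n"
proof (induction n rule: less_induct)
  case (less n)
  show ?case
  proof (cases "n \<le> 1")
    case True
    then have "{p. prime p \<and> p \<le> n} = {}" by (auto dest: prime_gt_1_nat)
    then show ?thesis by (simp only: chebyshev_theta_def) simp
  next
    case False
    have "chebyshev_theta n \<le> chebyshev_theta ((n + 1) div 2) + real n * ln 2" by (rule chebyshev_theta_halve)
    also have "chebyshev_theta ((n + 1) div 2) \<le> 4 * ln 2 * real ((n + 1) div 2)"
      by (rule less.IH) (use False in auto)
    also have "\<dots> \<le> 4 * ln 2 * ((real n + 1) / 2)"
      by (intro mult_left_mono) (simp_all add: field_simps)
    also have "4 * ln 2 * ((real n + 1) / 2) + real n * ln 2 = ln 2 * (2 * (real n + 1) + real n)"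
      by (simp add: algebra_simps)
    also have "\<dots> \<le> ln 2 * (4 * real n)"
      using False by (intro mult_left_mono) auto
    finally show ?thesis by (simp add: mult_ac)
  qed
qed

text \<open>
  Primes above \<open>sqrt n\<close> contribute at least \<open>ln n / 2\<close> each to \<open>chebyshev_theta n\<close>; there are at most
  \<open>sqrt n\<close> others.
\<close>

lemma primes_count_ln_le:
  assumes "2 \<le> n"
  shows "real (card {p. prime p \<and> p \<le> n}) * ln (real n) \<le> 10 * real n"
proof -
  let ?A = "{p. prime p \<and> p \<le> n}"
  let ?B = "{p. prime p \<and> p \<le> n \<and> sqrt (real n) < real p}"
  let ?C = "{p::nat. 1 \<le> p \<and> real p \<le> sqrt (real n)}"
  have finC: "?C \<subseteq> {1..nat \<lfloor>sqrt (real n)\<rfloor>}" by (auto simp: le_nat_floor)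
  have L: "0 < ln (real n)" using assms by simp
  have "card ?A \<le> card (?B \<union> ?C)"
    by (rule card_mono) (use finite_subset[OF finC] finite_subset[OF _ finite_primes_le[of n], of ?B] 
       in \<open>auto dest: prime_ge_1_nat\<close>)
  also have "\<dots> \<le> card ?B + card ?C" by (rule card_Un_le)
  finally have "real (card ?A) \<le> real (card ?B) + real (card ?C)" by linarith
  also have "real (card ?C) \<le> sqrt (real n)"
  proof -
    have "card ?C \<le> card {1..nat \<lfloor>sqrt (real n)\<rfloor>}" using finC by (intro card_mono) auto
    then have "card ?C \<le> nat \<lfloor>sqrt (real n)\<rfloor>" by simp
    then have "real (card ?C) \<le> real (nat \<lfloor>sqrt (real n)\<rfloor>)" by (rule of_nat_mono)
    also have "\<dots> \<le> sqrt (real n)" by simp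
    finally show ?thesis .
  qed
  finally have split: "real (card ?A) * ln (real n)
      \<le> real (card ?B) * ln (real n) + sqrt (real n) * ln (real n)"
    using L mult_right_mono[of "real (card ?A)" "real (card ?B) + sqrt (real n)" "ln (real n)"]
    by (simp add: distrib_right)
  have "real (card ?B) * (ln (real n) / 2) = (\<Sum>p\<in>?B. ln (sqrt (real n)))"
    using assms by (simp add: ln_sqrt)
  also have "\<dots> \<le> (\<Sum>p\<in>?B. ln (real p))"
    by (rule sum_mono) (use assms in \<open>auto simp: prime_gt_0_nat\<close>)
  also have "\<dots> \<le> chebyshev_theta n"
    unfolding chebyshev_theta_def
    by (rule sum_mono2[OF finite_primes_le]) (auto dest: prime_ge_1_nat)
  also have "\<dots> \<le> 4 * ln 2 * real n" by (rule chebyshev_theta_le)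
  also have "\<dots> \<le> 4 * 1 * real n"
    using ln_2_less_1 by (intro mult_right_mono mult_left_mono) auto
  finally have B: "real (card ?B) * ln (real n) \<le> 8 * real n" by simp
  have "ln (real n) = 2 * ln (sqrt (real n))" using assms by (simp add: ln_sqrt)
  also have "\<dots> \<le> 2 * sqrt (real n)"
  proof (rule mult_left_mono)
    have "0 < sqrt (real n)" using assms by simp
    then show "ln (sqrt (real n)) \<le> sqrt (real n)" by (rule less_imp_le[OF ln_less_self])
  qed simp
  finally have "sqrt (real n) * ln (real n) \<le> sqrt (real n) * (2 * sqrt (real n))"
    by (intro mult_left_mono) auto
  also have "\<dots> = 2 * real n" by simp
  finally show ?thesis using split B by linarith
qed

section \<open>Champions are nearly as large as the upper bound allows\<close>

definition smooth_upto :: "nat \<Rightarrow> nat \<Rightarrow> nat set" where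
  "smooth_upto y n = {j. 1 \<le> j \<and> j \<le> n \<and> (\<forall>p. prime p \<longrightarrow> p dvd j \<longrightarrow> p \<le> y)}"

lemma finite_smooth_upto: "finite (smooth_upto y n)"
  by (rule finite_subset[of _ "{..n}"]) (auto simp: smooth_upto_def)

text \<open>
  Keep in the recursion of \<open>K\<close> only the first factors \<open>m \<le> y\<close>. Such \<open>m\<close> are themselves
  \<open>y\<close>-smooth, so \<open>j \<mapsto> m * j\<close> preserves smoothness.
\<close>

lemma smooth_sum_rec:
  "(\<Sum>m=2..y. \<Sum>j\<in>smooth_upto y (n div m). kalmar_K j) \<le> (\<Sum>j\<in>smooth_upto y n. kalmar_K j)"
proof -
  have "(\<Sum>m=2..y. \<Sum>j\<in>smooth_upto y (n div m). kalmar_K j)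
      \<le> (\<Sum>m=2..y. \<Sum>j\<in>smooth_upto y n. if m dvd j then kalmar_K (j div m) else 0)"
  proof (rule sum_mono)
    fix m assume m: "m \<in> {2..y}"
    have "(\<Sum>j\<in>smooth_upto y (n div m). kalmar_K j)
        = (\<Sum>j\<in>(*) m ` smooth_upto y (n div m). if m dvd j then kalmar_K (j div m) else 0)"
      using m by (subst sum.reindex) (auto simp: inj_on_def intro!: sum.cong)
    also have "\<dots> \<le> (\<Sum>j\<in>smooth_upto y n. if m dvd j then kalmar_K (j div m) else 0)"
    proof (rule sum_mono2[OF finite_smooth_upto])
      show "(*) m ` smooth_upto y (n div m) \<subseteq> smooth_upto y n"
      proof
        fix k assume "k \<in> (*) m ` smooth_upto y (n div m)"
        then obtain j where j: "k = m * j" "j \<in> smooth_upto y (n div m)" by auto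
        have "m * j \<le> m * (n div m)" using j(2) by (simp add: smooth_upto_def)
        also have "\<dots> \<le> n" by simp
        finally have "m * j \<le> n" .
        moreover have "p \<le> y" if "prime p" "p dvd m * j" for p
          using that j(2) m dvd_imp_le[of p m] by (fastforce simp: smooth_upto_def prime_dvd_mult_iff)
        ultimately show "k \<in> smooth_upto y n" using j m by (auto simp: smooth_upto_def)
      qed
    qed auto
    finally show "(\<Sum>j\<in>smooth_upto y (n div m). kalmar_K j)
        \<le> (\<Sum>j\<in>smooth_upto y n. if m dvd j then kalmar_K (j div m) else 0)" .
  qed
  also have "\<dots> = (\<Sum>j\<in>smooth_upto y n. \<Sum>m=2..y. if m dvd j then kalmar_K (j div m) else 0)"
    by (rule sum.swap)
  also have "\<dots> \<le> (\<Sum>j\<in>smooth_upto y n. kalmar_K j)"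
  proof (rule sum_mono)
    fix j assume "j \<in> smooth_upto y n"
    then have j: "1 \<le> j" by (simp add: smooth_upto_def)
    have "(\<Sum>m=2..y. if m dvd j then kalmar_K (j div m) else 0)
        = (\<Sum>m | 2 \<le> m \<and> m \<le> y \<and> m dvd j. kalmar_K (j div m))"
      by (subst sum.inter_filter[symmetric]) (auto intro!: sum.cong)
    also have "\<dots> \<le> kalmar_K j"
    proof (cases "j = 1")
      case True
      then have "{m. 2 \<le> m \<and> m \<le> y \<and> m dvd j} = {}" by auto
      then show ?thesis by (simp only: sum.empty)
    next
      case False
      then have j2: "2 \<le> j" using j by simp
      show ?thesis
        unfolding kalmar_K_rec[OF j2]
        by (rule sum_mono2[OF finite_divisors_ge_2[OF j2]]) auto
    qed
    finally show "(\<Sum>m=2..y. if m dvd j then kalmar_K (j div m) else 0) \<le> kalmar_K j" .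
  qed
  finally show ?thesis .
qed

text \<open>
  Induction along \<open>smooth_sum_rec\<close>: the exponent \<open>s\<close> is chosen such that the bound reproduces itself. Stating it
  with \<open>n + 1\<close> absorbs the rounding in \<open>n div m\<close>, as \<open>n div m + 1 \<ge> (n + 1) / m\<close>.
\<close>

lemma smooth_sum_ge:
  assumes "2 \<le> y" "0 \<le> s" "1 \<le> (\<Sum>m=2..y. real m powr (-s))" "1 \<le> n"
  shows "real y powr (-s) * (real n + 1) powr s \<le> (\<Sum>j\<in>smooth_upto y n. real (kalmar_K j))"
  using \<open>1 \<le> n\<close>
proof (induction n rule: less_induct)
  case (less n)
  show ?case
  proof (cases "n < y")
    case True
    have "real y powr (-s) * (real n + 1) powr s \<le> real y powr (-s) * real y powr s"
      using True assms by (intro mult_left_mono powr_mono2) auto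
    also have "\<dots> = real (kalmar_K 1)" using assms by (simp add: powr_minus kalmar_K_1)
    also have "\<dots> \<le> (\<Sum>j\<in>smooth_upto y n. real (kalmar_K j))"
      by (rule member_le_sum) (use less.prems finite_smooth_upto in \<open>auto simp: smooth_upto_def\<close>)
    finally show ?thesis .
  next
    case False
    let ?c = "real y powr (-s)"
    have "?c * (real n + 1) powr s * 1 \<le> ?c * (real n + 1) powr s * (\<Sum>m=2..y. real m powr (-s))"
      using assms by (intro mult_left_mono) auto
    also have "\<dots> = (\<Sum>m=2..y. ?c * ((real n + 1) / real m) powr s)"
      unfolding sum_distrib_left by (intro sum.cong) (auto simp: powr_divide powr_minus field_simps)
    also have "\<dots> \<le> (\<Sum>m=2..y. \<Sum>j\<in>smooth_upto y (n div m). real (kalmar_K j))"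
    proof (rule sum_mono)
      fix m assume m: "m \<in> {2..y}"
      have "n < m * (n div m + 1)"
        using m dividend_less_times_div[of m n] by simp
      then have "n + 1 \<le> m * (n div m + 1)" by simp
      then have "real (n + 1) \<le> real (m * (n div m + 1))" by (rule of_nat_mono)
      then have "(real n + 1) / real m \<le> real (n div m) + 1"
        using m by (simp add: divide_le_eq algebra_simps)
      then have "?c * ((real n + 1) / real m) powr s \<le> ?c * (real (n div m) + 1) powr s"
        using assms by (intro mult_left_mono powr_mono2) auto
      also have "\<dots> \<le> (\<Sum>j\<in>smooth_upto y (n div m). real (kalmar_K j))"
      proof (rule less.IH)
        show "n div m < n" using m less.prems by simp
        show "1 \<le> n div m" using m False by (simp add: Suc_le_eq div_greater_zero_iff)
      qed
      finally show "?c * ((real n + 1) / real m) powr s \<le> (\<Sum>j\<in>smooth_upto y (n div m). real (kalmar_K j))" .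
    qed
    also have "\<dots> = real (\<Sum>m=2..y. \<Sum>j\<in>smooth_upto y (n div m). kalmar_K j)" by simp
    also have "\<dots> \<le> real (\<Sum>j\<in>smooth_upto y n. kalmar_K j)"
      by (rule of_nat_mono[OF smooth_sum_rec])
    finally show ?thesis by simp
  qed
qed

lemma half_le_ln_2: "1 / 2 \<le> ln (2::real)"
  using ln_le_minus_one[of "1 / 2 :: real"] by (simp add: ln_div)

text \<open>
  A smooth number is determined by its exponents at the primes up to \<open>y\<close>, each of which is at most
  \<open>ln n / ln 2 \<le> 2 * ln n\<close>.
\<close>

lemma card_smooth_upto_le:
  assumes "1 \<le> n"
  shows "real (card (smooth_upto y n)) \<le> (2 * ln (real n) + 1) ^ card {p. prime p \<and> p \<le> y}"
proof -
  let ?P = "{p. prime p \<and> p \<le> y}"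
  define k where "k = nat \<lfloor>2 * ln (real n)\<rfloor>"
  define v where "v j = restrict (\<lambda>p. multiplicity p j) ?P" for j :: nat
  have "inj_on v (smooth_upto y n)"
  proof (rule inj_onI)
    fix i j assume i: "i \<in> smooth_upto y n" and j: "j \<in> smooth_upto y n" and eq: "v i = v j"
    have mult: "multiplicity p i = multiplicity p j" if p: "prime p" for p
    proof (cases "p \<le> y")
      case True
      then show ?thesis using fun_cong[OF eq, of p] p by (simp add: v_def)
    next
      case False
      then have "\<not> p dvd i" "\<not> p dvd j" using i j p by (auto simp: smooth_upto_def)
      then show ?thesis by (simp add: not_dvd_imp_multiplicity_0)
    qed
    show "i = j"
      by (rule multiplicity_eq_nat[OF _ _ mult]) (use i j in \<open>auto simp: smooth_upto_def\<close>)
  qed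
  moreover have "v ` smooth_upto y n \<subseteq> PiE ?P (\<lambda>_. {..k})"
  proof
    fix f assume "f \<in> v ` smooth_upto y n"
    then obtain j where j: "f = v j" "j \<in> smooth_upto y n" by auto
    have "multiplicity p j \<le> k" if p: "prime p" for p
    proof -
      have "p ^ multiplicity p j \<le> n"
        using dvd_imp_le[OF multiplicity_dvd[of p j]] j(2) by (auto simp: smooth_upto_def)
      moreover have "2 ^ multiplicity p j \<le> p ^ multiplicity p j"
        using prime_ge_2_nat[OF p] by (intro power_mono) auto
      ultimately have "2 ^ multiplicity p j \<le> n" by linarith
      then have "real (2 ^ multiplicity p j) \<le> real n" by (rule of_nat_mono)
      then have "ln ((2::real) ^ multiplicity p j) \<le> ln (real n)"
        using assms by (subst ln_le_cancel_iff) auto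
      then have *: "real (multiplicity p j) * ln 2 \<le> ln (real n)" by (simp add: ln_realpow)
      have "real (multiplicity p j) * (1 / 2) \<le> real (multiplicity p j) * ln 2"
        using half_le_ln_2 by (intro mult_left_mono) auto
      with * have "real (multiplicity p j) \<le> 2 * ln (real n)" by linarith
      then show ?thesis unfolding k_def by (rule le_nat_floor)
    qed
    then show "f \<in> PiE ?P (\<lambda>_. {..k})" by (auto simp: j(1) v_def)
  qed
  ultimately have "card (smooth_upto y n) \<le> card (PiE ?P (\<lambda>_. {..k}))"
    by (rule card_inj_on_le) (intro finite_PiE finite_primes_le finite_atMost)
  also have "\<dots> = (k + 1) ^ card ?P"
    by (simp add: card_PiE finite_primes_le)
  finally have "real (card (smooth_upto y n)) \<le> real ((k + 1) ^ card ?P)" by (rule of_nat_mono)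
  also have "\<dots> = (real k + 1) ^ card ?P" by (simp add: add.commute)
  also have "\<dots> \<le> (2 * ln (real n) + 1) ^ card ?P"
    using assms by (intro power_mono) (auto simp: k_def)
  finally show ?thesis .
qed

text \<open>
  This bounds \<open>m powr -(1 + a)\<close> by the integral of \<open>u powr -(1 + a)\<close> over \<open>[m - 1, m]\<close>, so that it telescopes.
\<close>

lemma powr_tail_step:
  assumes "0 < a" "2 \<le> m"
  shows "real m powr (-(1 + a)) \<le> (real (m - 1) powr (-a) - real m powr (-a)) / a"
proof -
  have m: "2 \<le> real m" "real (m - 1) = real m - 1" using assms by auto
  have "ln (real m - 1) - ln (real m) = ln ((real m - 1) / real m)"
    using m by (simp add: ln_div)
  also have "\<dots> \<le> (real m - 1) / real m - 1"
    using m by (intro ln_le_minus_one) auto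
  also have "\<dots> = - 1 / real m" using m by (simp add: field_simps)
  finally have ln_le: "ln (real m - 1) \<le> ln (real m) - 1 / real m" by simp
  have "real m powr (-a) * (1 + a / real m) \<le> real m powr (-a) * exp (a / real m)"
    by (intro mult_left_mono exp_ge_add_one_self) auto
  also have "\<dots> = exp (-a * (ln (real m) - 1 / real m))"
    using m by (simp add: powr_def exp_add[symmetric] algebra_simps)
  also have "\<dots> \<le> exp (-a * ln (real m - 1))"
    using ln_le assms by simp
  also have "\<dots> = real (m - 1) powr (-a)" using m by (simp add: powr_def)
  finally have "a * (real m powr (-a) / real m) \<le> real (m - 1) powr (-a) - real m powr (-a)"
    by (simp add: algebra_simps)
  moreover have "-(1 + a) = -a - 1" by simp
  then have "real m powr (-(1 + a)) = real m powr (-a) / real m"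
    using m powr_diff[of "real m" "-a" 1] by (simp only:) simp
  ultimately show ?thesis
    using assms by (simp only: pos_le_divide_eq) (simp add: mult.commute)
qed

lemma zeta_tail_le:
  assumes "1 \<le> y"
  shows "1 \<le> (\<Sum>m=2..y. real m powr (-kalmar_rho)) + real y powr (1 - kalmar_rho) / (kalmar_rho - 1)"
proof -
  let ?f = "\<lambda>m::nat. real m powr (-kalmar_rho)"
  define a where "a = kalmar_rho - 1"
  have a: "0 < a" "-(1 + a) = -kalmar_rho" "-a = 1 - kalmar_rho" using kalmar_rho by (auto simp: a_def)
  have partial: "sum ?f {1..M} \<le> sum ?f {1..y} + (real y powr (-a) - real M powr (-a)) / a" if "y \<le> M" for M
    using that
  proof (induction M rule: dec_induct)
    case (step n)
    have "?f (Suc n) \<le> (real n powr (-a) - real (Suc n) powr (-a)) / a"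
      using powr_tail_step[OF a(1), of "Suc n"] step.hyps assms unfolding a(2) by simp
    with step.IH show ?case using assms by (simp add: diff_divide_distrib)
  qed simp
  have "2 \<le> sum ?f {1..y} + real y powr (-a) / a"
  proof (rule has_sum_le_finite_sums[OF rho_has_sum])
    fix F :: "nat set" assume F: "finite F" "F \<subseteq> {1..}"
    define M where "M = max y (Max (insert 0 F))"
    have "F \<subseteq> {1..M}" using F by (auto simp: M_def le_max_iff_disj)
    then have "sum ?f F \<le> sum ?f {1..M}" by (intro sum_mono2) auto
    also have "\<dots> \<le> sum ?f {1..y} + (real y powr (-a) - real M powr (-a)) / a"
      by (rule partial) (simp add: M_def)
    also have "\<dots> \<le> sum ?f {1..y} + real y powr (-a) / a"
      using a by (intro add_left_mono divide_right_mono) auto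
    finally show "sum ?f F \<le> sum ?f {1..y} + real y powr (-a) / a" .
  qed
  moreover have "{1..y} = insert 1 {2..y}" using assms by auto
  ultimately show ?thesis by (simp add: a(3)) (simp add: a_def)
qed

text \<open>
  Cutting the series at \<open>y\<close> loses \<open>O(y powr (1 - \<rho>))\<close>. Lowering the exponent by \<open>e\<close> multiplies each
  term by \<open>m powr e \<ge> 1 + e * ln m\<close>, and the gain at \<open>m = 2\<close> alone makes up for the loss.
\<close>

lemma truncated_zeta_exponent:
  obtains D where "0 < D"
    "\<And>y. 2 \<le> y \<Longrightarrow> 1 \<le> (\<Sum>m=2..y. real m powr (-(kalmar_rho - D * real y powr (1 - kalmar_rho))))"
proof
  define c where "c = 2 powr (-kalmar_rho) * ln 2"
  define D where "D = 1 / ((kalmar_rho - 1) * c)"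
  have c: "0 < c" by (simp add: c_def)
  then show D: "0 < D" using kalmar_rho(1) by (simp add: D_def)
  fix y :: nat assume y: "2 \<le> y"
  define e where "e = D * real y powr (1 - kalmar_rho)"
  have e: "0 \<le> e" using D by (simp add: e_def)
  have "1 \<le> (\<Sum>m=2..y. real m powr (-kalmar_rho)) + e * c"
    using zeta_tail_le[of y] y kalmar_rho(1) c by (simp add: e_def D_def)
  also have "c \<le> (\<Sum>m=2..y. real m powr (-kalmar_rho) * ln (real m))"
    unfolding c_def
    using member_le_sum[of 2 "{2..y}" "\<lambda>m. real m powr (-kalmar_rho) * ln (real m)"] y by auto
  also have "(\<Sum>m=2..y. real m powr (-kalmar_rho)) + e * (\<Sum>m=2..y. real m powr (-kalmar_rho) * ln (real m))
     = (\<Sum>m=2..y. real m powr (-kalmar_rho) * (1 + e * ln (real m)))"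
    by (simp add: sum.distrib sum_distrib_left algebra_simps)
  also have "\<dots> \<le> (\<Sum>m=2..y. real m powr (-(kalmar_rho - e)))"
  proof (rule sum_mono)
    fix m assume m: "m \<in> {2..y}"
    have "real m powr (-kalmar_rho) * (1 + e * ln (real m)) \<le> real m powr (-kalmar_rho) * exp (e * ln (real m))"
      by (intro mult_left_mono exp_ge_add_one_self) auto
    also have "\<dots> = real m powr (-(kalmar_rho - e))"
      using m by (simp add: powr_def exp_add[symmetric] algebra_simps)
    finally show "real m powr (-kalmar_rho) * (1 + e * ln (real m)) \<le> real m powr (-(kalmar_rho - e))" .
  qed
  finally show "1 \<le> (\<Sum>m=2..y. real m powr (-(kalmar_rho - D * real y powr (1 - kalmar_rho))))"
    using e by (simp add: e_def mult_left_mono)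
qed

lemma champion_ge_smooth_average:
  assumes "K_champion N"
  shows "(\<Sum>j\<in>smooth_upto y N. real (kalmar_K j)) \<le> real (card (smooth_upto y N)) * real (kalmar_K N)"
proof -
  have "(\<Sum>j\<in>smooth_upto y N. real (kalmar_K j)) \<le> (\<Sum>j\<in>smooth_upto y N. real (kalmar_K N))"
  proof (rule sum_mono)
    fix j assume "j \<in> smooth_upto y N"
    then show "real (kalmar_K j) \<le> real (kalmar_K N)"
      using assms by (cases "j = N") (auto simp: K_champion_def smooth_upto_def intro!: less_imp_le)
  qed
  then show ?thesis by simp
qed

lemma ln_real_at_top: "filterlim (\<lambda>N::nat. ln (real N)) at_top at_top"
  by (rule filterlim_compose[OF ln_at_top filterlim_real_sequentially])

text \<open>
  With \<open>L = ln N\<close> and \<open>y\<close> about \<open>z = L powr (1 / \<rho>)\<close>, the three losses are all \<open>O(z)\<close>: lowering the exponent costs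
  \<open>y powr (1 - \<rho>) * L\<close>, the initial factor costs \<open>s * ln y\<close>, and the number of smooth integers costs
  \<open>\<pi>(y) * ln (2 * L + 1)\<close>, where \<open>ln L\<close> and \<open>ln y\<close> are comparable.
\<close>

lemma champion_lower_bound:
  "\<exists>C. \<forall>\<^sub>F N in champions_at_top.
     kalmar_rho * ln (real N) - C * ln (real N) powr (1 / kalmar_rho) \<le> ln (real (kalmar_K N))"
proof -
  let ?r = kalmar_rho
  obtain D where D: "0 < D" and trunc:
    "\<And>y. 2 \<le> y \<Longrightarrow> 1 \<le> (\<Sum>m=2..y. real m powr (-(?r - D * real y powr (1 - ?r))))"
    using truncated_zeta_exponent by blast
  have r: "1 < ?r" by (rule kalmar_rho)
  have "((\<lambda>N::nat. D * ln (real N) powr ((1 - ?r) / ?r)) \<longlongrightarrow> D * 0) at_top"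
    using r by (intro tendsto_mult tendsto_const tendsto_neg_powr[OF _ ln_real_at_top]) (simp add: field_simps)
  then have "\<forall>\<^sub>F N::nat in at_top. D * ln (real N) powr ((1 - ?r) / ?r) < ?r"
    by (rule order_tendstoD) (use r in simp)
  moreover have "\<forall>\<^sub>F N::nat in at_top. 3 \<le> ln (real N)"
    using ln_real_at_top by (simp add: filterlim_at_top)
  ultimately have ev: "\<forall>\<^sub>F N::nat in at_top. D * ln (real N) powr ((1 - ?r) / ?r) < ?r \<and> 3 \<le> ln (real N)"
    by (rule eventually_conj)
  have main: "?r * ln (real N) - (D + 42 * ?r) * ln (real N) powr (1 / ?r) \<le> ln (real (kalmar_K N))"
    if N: "K_champion N" and small: "D * ln (real N) powr ((1 - ?r) / ?r) < ?r" and L3: "3 \<le> ln (real N)" for N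
  proof -
    define L where "L = ln (real N)"
    define z where "z = L powr (1 / ?r)"
    define y where "y = nat \<lceil>z\<rceil>"
    have L: "3 \<le> L" using L3 by (simp add: L_def)
    have N1: "1 \<le> N" using N by (simp add: K_champion_def)
    have z1: "1 < z" unfolding z_def using L r by (intro gr_one_powr) auto
    have y: "z \<le> real y" "real y \<le> 2 * z" using z1 by (auto simp: y_def) linarith
    have y2: "2 \<le> y" using z1 y(1) by linarith
    define s where "s = ?r - D * real y powr (1 - ?r)"
    have "real y powr (1 - ?r) \<le> z powr (1 - ?r)"
      using y z1 r by (intro powr_mono2') auto
    also have "\<dots> = L powr ((1 - ?r) / ?r)" by (simp add: z_def powr_powr)
    finally have eps: "D * real y powr (1 - ?r) \<le> D * L powr ((1 - ?r) / ?r)"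
      using D by (intro mult_left_mono) auto
    then have s: "0 \<le> s" using small unfolding s_def L_def by linarith
    have "s \<le> ?r" using D by (simp add: s_def)
    have "D * real y powr (1 - ?r) * L \<le> D * L powr ((1 - ?r) / ?r) * L"
      using L eps by (intro mult_right_mono) auto
    also have "\<dots> = D * (L powr ((1 - ?r) / ?r) * L powr 1)" using L by simp
    also have "\<dots> = D * z"
      using r by (simp only: powr_add[symmetric] z_def) (simp add: field_simps)
    finally have eL: "D * real y powr (1 - ?r) * L \<le> D * z" .
    let ?pi = "card {p. prime p \<and> p \<le> y}"
    have "real y powr (-s) * real N powr s \<le> real y powr (-s) * (real N + 1) powr s"
      using s by (intro mult_left_mono powr_mono2) auto
    also have "\<dots> \<le> (\<Sum>j\<in>smooth_upto y N. real (kalmar_K j))"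
      using trunc[OF y2] by (intro smooth_sum_ge[OF y2 s _ N1]) (simp add: s_def)
    also have "\<dots> \<le> real (card (smooth_upto y N)) * real (kalmar_K N)"
      by (rule champion_ge_smooth_average[OF N])
    also have "\<dots> \<le> (2 * L + 1) ^ ?pi * real (kalmar_K N)"
      using card_smooth_upto_le[OF N1] by (intro mult_right_mono) (auto simp: L_def)
    finally have le: "real y powr (-s) * real N powr s \<le> (2 * L + 1) ^ ?pi * real (kalmar_K N)" .
    have K: "0 < real (kalmar_K N)" using kalmar_K_pos[OF N1] by simp
    have "ln (real y powr (-s) * real N powr s) \<le> ln ((2 * L + 1) ^ ?pi * real (kalmar_K N))"
      using le N1 y2 L K by (subst ln_le_cancel_iff) auto
    then have *: "- s * ln (real y) + s * L \<le> real ?pi * ln (2 * L + 1) + ln (real (kalmar_K N))"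
      using N1 y2 L K by (simp add: ln_mult ln_powr ln_realpow L_def)
    have "s * ln (real y) \<le> ?r * real y"
      using \<open>s \<le> ?r\<close> y2 less_imp_le[OF ln_less_self[of "real y"]] r by (intro mult_mono) auto
    also have "\<dots> \<le> ?r * (2 * z)" using y r by (intro mult_left_mono) auto
    finally have t1: "s * ln (real y) \<le> 2 * ?r * z" by simp
    have "2 * L + 1 \<le> L * L" using mult_right_mono[OF L, of L] L by linarith
    then have "ln (2 * L + 1) \<le> ln (L * L)" using L by (subst ln_le_cancel_iff) auto
    also have "\<dots> = 2 * ?r * ln z" using L r by (simp add: ln_mult z_def ln_powr)
    also have "\<dots> \<le> 2 * ?r * ln (real y)"
      using y z1 r y2 by (intro mult_left_mono) auto
    finally have "real ?pi * ln (2 * L + 1) \<le> real ?pi * (2 * ?r * ln (real y))"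
      by (intro mult_left_mono) auto
    also have "\<dots> = 2 * ?r * (real ?pi * ln (real y))" by simp
    also have "\<dots> \<le> 2 * ?r * (10 * real y)"
      using primes_count_ln_le[OF y2] r by (intro mult_left_mono) auto
    also have "\<dots> \<le> 2 * ?r * (10 * (2 * z))"
      using y r by (intro mult_left_mono) auto
    finally have t2: "real ?pi * ln (2 * L + 1) \<le> 40 * ?r * z" by simp
    have "s * L = ?r * L - D * real y powr (1 - ?r) * L" by (simp add: s_def algebra_simps)
    with * t1 t2 eL have "?r * L - (D + 42 * ?r) * z \<le> ln (real (kalmar_K N))"
      by (simp add: algebra_simps)
    then show ?thesis by (simp add: L_def z_def)
  qed
  have "\<forall>\<^sub>F N in champions_at_top. ?r * ln (real N) - (D + 42 * ?r) * ln (real N) powr (1 / ?r) \<le> ln (real (kalmar_K N))"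
    unfolding champions_at_top_def eventually_inf_principal
    using ev by eventually_elim (use main in auto)
  then show ?thesis by blast
qed

section \<open>Comparison of the two bounds\<close>

text \<open>
  Since \<open>1 / \<rho> = 2 * \<delta> - 1\<close>, the choice \<open>x = \<plusminus> L powr (\<delta> - 1)\<close> with \<open>L = ln N\<close> makes both \<open>x\<^sup>2 * L\<close> and the
  defect of the champion of order \<open>L powr (1 / \<rho>)\<close>; the two signs bound the deviation from both sides.
\<close>

lemma champion_additive_deviation:
  obtains C where "\<forall>\<^sub>F N in champions_at_top. \<forall>h S.
     (\<forall>p. prime p \<longrightarrow> 0 \<le> h p \<and> h p \<le> 2 * ln (real p)) \<longrightarrow>
     ((\<lambda>p. h p / (real p powr kalmar_rho - 1)) has_sum S) {p. prime p} \<longrightarrow>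
     \<bar>additive_ext h N - kalmar_a * S * ln (real N)\<bar> \<le> C * ln (real N) powr kalmar_delta"
proof (rule kalmar_K_additive_bound)
  fix C1 x0 :: real
  assume x0: "0 < x0" and upper: "\<And>h S x n. \<lbrakk>\<And>p. prime p \<Longrightarrow> 0 \<le> h p \<and> h p \<le> 2 * ln (real p);
           ((\<lambda>p. h p / (real p powr kalmar_rho - 1)) has_sum S) {p. prime p}; \<bar>x\<bar> \<le> x0; 1 \<le> n\<rbrakk> \<Longrightarrow>
           ln (real (kalmar_K n)) \<le> kalmar_rho * ln (real n)
             - x * (additive_ext h n - kalmar_a * S * ln (real n)) + C1 * x\<^sup>2 * ln (real n)"
  obtain C2 where lower: "\<forall>\<^sub>F N in champions_at_top.
     kalmar_rho * ln (real N) - C2 * ln (real N) powr (1 / kalmar_rho) \<le> ln (real (kalmar_K N))"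
    using champion_lower_bound by blast
  let ?d = kalmar_delta
  have rho: "1 / kalmar_rho = 2 * ?d - 1" by (simp add: kalmar_delta_def field_simps)
  have "?d < 1" using kalmar_rho(1) by (simp add: kalmar_delta_def)
  have "((\<lambda>N::nat. ln (real N) powr (?d - 1)) \<longlongrightarrow> 0) at_top"
    using \<open>?d < 1\<close> by (intro tendsto_neg_powr[OF _ ln_real_at_top]) simp
  then have "\<forall>\<^sub>F N::nat in at_top. ln (real N) powr (?d - 1) < x0"
    by (rule order_tendstoD) (rule x0)
  moreover have "\<forall>\<^sub>F N::nat in at_top. 1 \<le> ln (real N)"
    using ln_real_at_top by (simp add: filterlim_at_top)
  ultimately have "\<forall>\<^sub>F N::nat in at_top. 1 \<le> ln (real N) \<and> ln (real N) powr (?d - 1) < x0"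
    by eventually_elim simp
  then have large: "\<forall>\<^sub>F N in champions_at_top. 1 \<le> ln (real N) \<and> ln (real N) powr (?d - 1) < x0"
    unfolding champions_at_top_def by (rule filter_leD[OF inf_le1])
  show thesis
  proof (rule that[of "C1 + C2"], use lower large in eventually_elim, intro allI impI)
    fix N :: nat and h :: "nat \<Rightarrow> real" and S :: real
    assume low: "kalmar_rho * ln (real N) - C2 * ln (real N) powr (1 / kalmar_rho) \<le> ln (real (kalmar_K N))"
      and N: "1 \<le> ln (real N) \<and> ln (real N) powr (?d - 1) < x0"
      and h: "\<forall>p. prime p \<longrightarrow> 0 \<le> h p \<and> h p \<le> 2 * ln (real p)"
      and S: "((\<lambda>p. h p / (real p powr kalmar_rho - 1)) has_sum S) {p. prime p}"
    define L where "L = ln (real N)"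
    define dev where "dev = additive_ext h N - kalmar_a * S * L"
    have L: "1 \<le> L" using N by (simp add: L_def)
    have N1: "1 \<le> N" using N by (cases "N = 0") auto
    have signed: "c * dev \<le> (C1 + C2) * L powr ?d" if c: "\<bar>c\<bar> = 1" for c
    proof -
      let ?x = "c * L powr (?d - 1)"
      have c2: "c\<^sup>2 = 1" using c by (metis power2_abs one_power2)
      have "\<bar>?x\<bar> \<le> x0" using N c by (simp add: abs_mult L_def)
      from upper[OF _ S this N1] h
      have "ln (real (kalmar_K N)) \<le> kalmar_rho * L - ?x * dev + C1 * ?x\<^sup>2 * L"
        by (simp add: L_def dev_def)
      then have "?x * dev \<le> C1 * ?x\<^sup>2 * L + C2 * L powr (1 / kalmar_rho)"
        using low by (simp add: L_def)
      also have "?x\<^sup>2 * L = L powr (1 / kalmar_rho)"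
      proof -
        have "?x\<^sup>2 * L = L powr (?d - 1) * L powr (?d - 1) * L powr 1"
          using L c2 by (simp add: power_mult_distrib power2_eq_square[of "L powr _"])
        also have "\<dots> = L powr (1 / kalmar_rho)"
          unfolding rho by (simp only: powr_add[symmetric]) (simp add: algebra_simps)
        finally show ?thesis .
      qed
      then have "C1 * ?x\<^sup>2 * L = C1 * L powr (1 / kalmar_rho)" by (simp only: mult.assoc)
      finally have "L powr (?d - 1) * (c * dev) \<le> (C1 + C2) * L powr (1 / kalmar_rho)"
        by (simp add: algebra_simps)
      then have "L powr (1 - ?d) * (L powr (?d - 1) * (c * dev))
          \<le> L powr (1 - ?d) * ((C1 + C2) * L powr (1 / kalmar_rho))"
        by (intro mult_left_mono) auto
      moreover have "L powr (1 - ?d) * L powr (?d - 1) = 1"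
        using L by (simp add: powr_add[symmetric])
      moreover have "L powr (1 - ?d) * L powr (1 / kalmar_rho) = L powr ?d"
        unfolding rho by (simp add: powr_add[symmetric])
      ultimately show ?thesis
        by (metis (no_types, opaque_lifting) mult.assoc mult.left_commute mult_1)
    qed
    have "\<bar>dev\<bar> \<le> (C1 + C2) * L powr ?d"
      using signed[of 1] signed[of "-1"] by auto
    then show "\<bar>additive_ext h N - kalmar_a * S * ln (real N)\<bar> \<le> (C1 + C2) * ln (real N) powr ?d"
      by (simp add: dev_def L_def)
  qed
qed

lemma nth_pr_prime: "1 \<le> i \<Longrightarrow> prime (nth_pr i)"
  unfolding nth_pr_def using enumerate_in_set[of "{p::nat. prime p}"] primes_infinite by auto

lemma nth_pr_inj_on: "inj_on nth_pr {1..k}"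
proof (rule inj_onI)
  fix i j assume ij: "i \<in> {1..k}" "j \<in> {1..k}" and "nth_pr i = nth_pr j"
  then have "nth_pr (Suc (i - 1)) = nth_pr (Suc (j - 1))" by simp
  then have "i - 1 = j - 1"
    by (rule injD[OF bij_betw_imp_inj_on[OF nth_pr_bij]])
  moreover have "1 \<le> i" "1 \<le> j" using ij by auto
  ultimately show "i = j" by linarith
qed

lemma descending_factorization_multiplicity:
  assumes "descending_factorization N k \<alpha>"
  shows "i \<in> {1..k} \<Longrightarrow> multiplicity (nth_pr i) N = \<alpha> i"
    and "prime p \<Longrightarrow> p dvd N \<Longrightarrow> p \<in> nth_pr ` {1..k}"
proof -
  let ?A = "nth_pr ` {1..k}"
  define f where "f = \<alpha> \<circ> the_inv_into {1..k} nth_pr"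
  have f: "f (nth_pr i) = \<alpha> i" if "i \<in> {1..k}" for i
    unfolding f_def o_def by (subst the_inv_into_f_f[OF nth_pr_inj_on that]) (rule refl)
  have "N = (\<Prod>i=1..k. nth_pr i ^ f (nth_pr i))"
    using assms f by (simp add: descending_factorization_def)
  then have N: "N = (\<Prod>p\<in>?A. p ^ f p)"
    by (subst prod.reindex[OF nth_pr_inj_on]) (simp only: o_def)
  have mult: "multiplicity q N = (if q \<in> ?A then f q else 0)" if "prime q" for q
    unfolding N by (rule multiplicity_prod_prime_powers) (use that nth_pr_prime in auto)
  show "multiplicity (nth_pr i) N = \<alpha> i" if "i \<in> {1..k}" for i
    using mult[of "nth_pr i"] that nth_pr_prime[of i] f by auto
  assume p: "prime p" "p dvd N"
  then obtain q where q: "q \<in> ?A" "p dvd q ^ f q"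
    unfolding N by (auto simp: prime_dvd_prod_iff)
  then have "p dvd q" using p(1) prime_dvd_power by blast
  moreover have "prime q" using q(1) nth_pr_prime by auto
  ultimately have "p = q" using p(1) by (simp add: primes_dvd_imp_eq)
  then show "p \<in> ?A" using q(1) by simp
qed

lemma descending_factorization_Omega:
  assumes "1 \<le> N" "descending_factorization N k \<alpha>"
  shows "prime_Omega N = (\<Sum>i=1..k. \<alpha> i)"
proof -
  have "real (prime_Omega N) = additive_ext (\<lambda>_. 1) N" by (simp add: additive_ext_Omega)
  also have "\<dots> = (\<Sum>p\<in>nth_pr ` {1..k}. real (multiplicity p N) * 1)"
    by (rule additive_ext_superset)
      (use assms nth_pr_prime descending_factorization_multiplicity(2)[OF assms(2)]
        in \<open>auto simp: in_prime_factors_iff\<close>)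
  also have "\<dots> = (\<Sum>i=1..k. real (multiplicity (nth_pr i) N))"
    by (subst sum.reindex[OF nth_pr_inj_on]) simp
  also have "\<dots> = real (\<Sum>i=1..k. \<alpha> i)"
    using descending_factorization_multiplicity(1)[OF assms(2)] by simp
  finally show ?thesis by linarith
qed

theorem mainTheorem3:
  shows "(\<forall>N k \<alpha>. K_champion N \<and> descending_factorization N k \<alpha> \<longrightarrow>
            prime_Omega N = (\<Sum>i=1..k. \<alpha> i))
       \<and> (\<lambda>N. real (prime_Omega N) - kalmar_b * ln (real N))
            \<in> O[champions_at_top](\<lambda>N. ln (real N) powr kalmar_delta)
       \<and> (\<exists>C::real. eventually (\<lambda>N. \<forall>k \<alpha>. descending_factorization N k \<alpha> \<longrightarrow>
            (\<forall>i\<in>{1..k}. \<bar>real (\<alpha> i) - kalmar_beta i * ln (real N)\<bar>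
               \<le> C * (ln (real N) powr kalmar_delta / ln (real (nth_pr i))))) champions_at_top)"
proof -
  obtain C where dev: "\<forall>\<^sub>F N in champions_at_top. \<forall>h S.
     (\<forall>p. prime p \<longrightarrow> 0 \<le> h p \<and> h p \<le> 2 * ln (real p)) \<longrightarrow>
     ((\<lambda>p. h p / (real p powr kalmar_rho - 1)) has_sum S) {p. prime p} \<longrightarrow>
     \<bar>additive_ext h N - kalmar_a * S * ln (real N)\<bar> \<le> C * ln (real N) powr kalmar_delta"
    using champion_additive_deviation by blast
  have champ: "\<forall>\<^sub>F N in champions_at_top. K_champion N"
    unfolding champions_at_top_def eventually_inf_principal by simp
  have one_le: "1 \<le> 2 * ln (real p)" if "prime p" for p
  proof -
    have "ln 2 \<le> ln (real p)" using prime_ge_2_nat[OF that] by (subst ln_le_cancel_iff) auto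
    then show ?thesis using half_le_ln_2 by linarith
  qed
  obtain S where S: "((\<lambda>p. 1 / (real p powr kalmar_rho - 1)) has_sum S) {p. prime p}"
    using additive_ext_has_sum[of "\<lambda>_. 1" 2] one_le by auto
  have b: "kalmar_b = kalmar_a * S"
    unfolding kalmar_b_def kalmar_beta_def
    using suminf_nth_pr[OF has_sum_cmult_right[OF S, of kalmar_a]] by simp
  have "\<forall>\<^sub>F N in champions_at_top. \<bar>real (prime_Omega N) - kalmar_b * ln (real N)\<bar>
          \<le> C * ln (real N) powr kalmar_delta"
    using dev
  proof eventually_elim
    case (elim N)
    from elim[rule_format, of "\<lambda>_. 1" S] S one_le
    show ?case by (simp add: additive_ext_Omega b)
  qed
  then have Omega: "(\<lambda>N. real (prime_Omega N) - kalmar_b * ln (real N))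
            \<in> O[champions_at_top](\<lambda>N. ln (real N) powr kalmar_delta)"
    by (intro bigoI[of _ C]) (simp add: abs_mult)
  have exponents: "\<forall>\<^sub>F N in champions_at_top. \<forall>k \<alpha>. descending_factorization N k \<alpha> \<longrightarrow>
            (\<forall>i\<in>{1..k}. \<bar>real (\<alpha> i) - kalmar_beta i * ln (real N)\<bar>
               \<le> C * (ln (real N) powr kalmar_delta / ln (real (nth_pr i))))"
    using dev champ
  proof (eventually_elim, intro allI impI ballI)
    fix N k \<alpha> i
    assume dev: "\<forall>h S. (\<forall>p. prime p \<longrightarrow> 0 \<le> h p \<and> h p \<le> 2 * ln (real p)) \<longrightarrow>
     ((\<lambda>p. h p / (real p powr kalmar_rho - 1)) has_sum S) {p. prime p} \<longrightarrow>
     \<bar>additive_ext h N - kalmar_a * S * ln (real N)\<bar> \<le> C * ln (real N) powr kalmar_delta"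
      and N: "K_champion N" and fact: "descending_factorization N k \<alpha>" and i: "i \<in> {1..k}"
    define p where "p = nth_pr i"
    have p: "prime p" using i nth_pr_prime by (simp add: p_def)
    have lnp: "0 < ln (real p)" using prime_gt_1_nat[OF p] by simp
    have N1: "1 \<le> N" using N by (simp add: K_champion_def)
    define h where "h q = (if q = p then ln (real p) else 0)" for q
    have "\<forall>q. prime q \<longrightarrow> 0 \<le> h q \<and> h q \<le> 2 * ln (real q)"
      using lnp by (auto simp: h_def dest: prime_ge_1_nat)
    moreover have "((\<lambda>q. h q / (real q powr kalmar_rho - 1))
        has_sum (ln (real p) / (real p powr kalmar_rho - 1))) {q. prime q}"
      by (rule has_sum_finite_neutralI[of "{p}"]) (use p in \<open>auto simp: h_def\<close>)
    ultimately have "\<bar>additive_ext h N - kalmar_a * (ln (real p) / (real p powr kalmar_rho - 1)) * ln (real N)\<bar>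
        \<le> C * ln (real N) powr kalmar_delta"
      using dev by blast
    also have "additive_ext h N = real (\<alpha> i) * ln (real p)"
      using additive_ext_single[OF p N1] descending_factorization_multiplicity(1)[OF fact i]
      unfolding h_def by (simp add: p_def)
    also have "real (\<alpha> i) * ln (real p) - kalmar_a * (ln (real p) / (real p powr kalmar_rho - 1)) * ln (real N)
       = (real (\<alpha> i) - kalmar_beta i * ln (real N)) * ln (real p)"
      by (simp add: kalmar_beta_def p_def algebra_simps)
    finally have "\<bar>real (\<alpha> i) - kalmar_beta i * ln (real N)\<bar> * ln (real p) \<le> C * ln (real N) powr kalmar_delta"
      using lnp by (simp add: abs_mult)
    then show "\<bar>real (\<alpha> i) - kalmar_beta i * ln (real N)\<bar>
               \<le> C * (ln (real N) powr kalmar_delta / ln (real (nth_pr i)))"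
      using lnp by (simp add: p_def field_simps)
  qed
  show ?thesis
  proof (intro conjI allI impI)
    fix N k \<alpha> assume "K_champion N \<and> descending_factorization N k \<alpha>"
    then show "prime_Omega N = (\<Sum>i=1..k. \<alpha> i)"
      by (intro descending_factorization_Omega) (auto simp: K_champion_def)
  qed (use Omega exponents in blast)+
qed

end
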